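(* Let $p^*_{\mathrm{loc}}=\inf\{|q|(\overline\Omega): q\in\mathcal{M}(\overline\Omega;\mathbb{R}^n),\ -\int_{\overline\Omega}\nabla\phi\cdot dq=\int_\Omega f\phi\,dx\ \text{for all }\phi\in C^1_0(\overline\Omega)\}$ and $pd^*_{\mathrm{loc}}=\sup\{\int_\Omega fu\,dx: u\in C^1_0(\overline\Omega),\ \sup_{x\in\overline\Omega}|\nabla u(x)|\le1\}$. Then $p^*_{\mathrm{loc}}=pd^*_{\mathrm{loc}}$, and whenever $p^*_{\mathrm{loc}}<+\infty$ the infimum defining $p^*_{\mathrm{loc}}$ is attained.
   Context: $n\ge2$, $\Omega\subset\mathbb{R}^n$ is a bounded connected open set with Lipschitz boundary, and $f\in L^2(\Omega)$. $\mathcal{M}(\overline\Omega;\mathbb{R}^n)$ is the space of finite $\mathbb{R}^n$-valued Radon measures on $\overline\Omega$, $|q|(\overline\Omega)$ the total variation of $q$. $C^1_0(\overline\Omega)=\{\phi\in C^1(\overline\Omega):\phi=0\text{ on }\partial\Omega\}$; $|\cdot|$ is the Euclidean norm. *)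

theory Defs
  imports "HOL-Analysis.Analysis"
begin

text \<open>Lipschitz boundary: near every boundary point, after a rotation, the domain is the
  region above the graph of a Lipschitz function. Coordinate-free form: unit normal
  direction nu, Lipschitz function gamma of the component orthogonal to nu.\<close>
definition lipschitz_boundary :: "(real^'n) set \<Rightarrow> bool" where
  "lipschitz_boundary \<Omega> \<longleftrightarrow>
     (\<forall>x\<in>frontier \<Omega>. \<exists>r>0. \<exists>\<nu> L. \<exists>\<gamma> :: real^'n \<Rightarrow> real.
        norm \<nu> = 1 \<and> L-lipschitz_on UNIV \<gamma> \<and>
        \<Omega> \<inter> ball x r = {y \<in> ball x r. \<gamma> (y - (y \<bullet> \<nu>) *\<^sub>R \<nu>) < y \<bullet> \<nu>})"

text \<open>phi in C^1(closure Omega) with gradient g: phi is C^1 in Omega and phi and its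
  gradient extend continuously to the closure (g is the extended gradient).\<close>
definition C1_closure :: "(real^'n) set \<Rightarrow> (real^'n \<Rightarrow> real) \<Rightarrow> (real^'n \<Rightarrow> real^'n) \<Rightarrow> bool" where
  "C1_closure \<Omega> \<phi> g \<longleftrightarrow>
     continuous_on (closure \<Omega>) \<phi> \<and> continuous_on (closure \<Omega>) g \<and>
     (\<forall>x\<in>\<Omega>. (\<phi> has_derivative (\<lambda>h. g x \<bullet> h)) (at x))"

definition C1_0 :: "(real^'n) set \<Rightarrow> (real^'n \<Rightarrow> real) \<Rightarrow> (real^'n \<Rightarrow> real^'n) \<Rightarrow> bool" where
  "C1_0 \<Omega> \<phi> g \<longleftrightarrow> C1_closure \<Omega> \<phi> g \<and> (\<forall>x\<in>frontier \<Omega>. \<phi> x = 0)"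

text \<open>A finite R^n-valued Radon measure q on the compact set K is represented by the
  Jordan-type decomposition of its components: q_i = qp i - qm i with qp i, qm i
  finite Borel measures on R^n concentrated on K. (On a compact subset of R^n every
  finite Borel measure is Radon.)\<close>
definition vmeasure_on :: "(real^'n) set \<Rightarrow> ('n \<Rightarrow> (real^'n) measure) \<Rightarrow> ('n \<Rightarrow> (real^'n) measure) \<Rightarrow> bool" where
  "vmeasure_on K qp qm \<longleftrightarrow>
     (\<forall>i. sets (qp i) = sets borel \<and> finite_measure (qp i) \<and> emeasure (qp i) (UNIV - K) = 0 \<and>
          sets (qm i) = sets borel \<and> finite_measure (qm i) \<and> emeasure (qm i) (UNIV - K) = 0)"

definition vmeasure_val :: "('n \<Rightarrow> (real^'n) measure) \<Rightarrow> ('n \<Rightarrow> (real^'n) measure) \<Rightarrow> (real^'n) set \<Rightarrow> real^'n" where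
  "vmeasure_val qp qm E = (\<chi> i. measure (qp i) E - measure (qm i) E)"

definition total_variation :: "('n \<Rightarrow> (real^'n) measure) \<Rightarrow> ('n \<Rightarrow> (real^'n) measure) \<Rightarrow> (real^'n) set \<Rightarrow> ereal" where
  "total_variation qp qm S =
     (SUP P \<in> {P. finite P \<and> P \<subseteq> sets borel \<and> disjoint P \<and> \<Union>P = S}.
        ereal (\<Sum>E\<in>P. norm (vmeasure_val qp qm E)))"

definition vintegral :: "(real^'n) set \<Rightarrow> ('n \<Rightarrow> (real^'n) measure) \<Rightarrow> ('n \<Rightarrow> (real^'n) measure) \<Rightarrow> (real^'n \<Rightarrow> real^'n) \<Rightarrow> real" where
  "vintegral K qp qm g =
     (\<Sum>i\<in>UNIV. (LINT x:K|qp i. g x $ i) - (LINT x:K|qm i. g x $ i))"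

definition admissible :: "(real^'n) set \<Rightarrow> (real^'n \<Rightarrow> real) \<Rightarrow> ('n \<Rightarrow> (real^'n) measure) \<Rightarrow> ('n \<Rightarrow> (real^'n) measure) \<Rightarrow> bool" where
  "admissible \<Omega> f qp qm \<longleftrightarrow> vmeasure_on (closure \<Omega>) qp qm \<and>
     (\<forall>\<phi> g. C1_0 \<Omega> \<phi> g \<longrightarrow>
        - vintegral (closure \<Omega>) qp qm g = (LINT x:\<Omega>|lebesgue. f x * \<phi> x))"

definition p_loc :: "(real^'n) set \<Rightarrow> (real^'n \<Rightarrow> real) \<Rightarrow> ereal" where
  "p_loc \<Omega> f = (INF q \<in> {(qp, qm). admissible \<Omega> f qp qm}.
                   total_variation (fst q) (snd q) (closure \<Omega>))"

definition pd_loc :: "(real^'n) set \<Rightarrow> (real^'n \<Rightarrow> real) \<Rightarrow> ereal" where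
  "pd_loc \<Omega> f = (SUP u \<in> {u. \<exists>g. C1_0 \<Omega> u g \<and> (\<forall>x\<in>closure \<Omega>. norm (g x) \<le> 1)}.
                    ereal (LINT x:\<Omega>|lebesgue. f x * u x))"

end

theory Submission
  imports Defs "HOL-Library.Function_Algebras"
begin

text \<open>Weak duality holds because the integral of a continuous field bounded by 1 against a vector
  measure is at most its total variation. Conversely, if the dual value is a finite number M, the
  map sending a gradient field \<open>\<nabla>\<phi>\<close> to \<open>- \<integral> f \<phi>\<close> is bounded by M times the supremum norm on the
  closure of the domain. The Hahn-Banach theorem extends it with the same bound to all continuous
  fields, and the Riesz representation of the extension is an admissible measure of total variation
  at most M, hence a minimiser.\<close>

section \<open>The Hahn-Banach theorem\<close>

text \<open>Two points shape the proof. The first is that the map on gradients has to be well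
  defined. Instead of recovering \<phi> from its gradient, the pairs (gradient of \<phi>, minus the
  integral of f \<phi>) are kept as a linear relation: the bound by M times the supremum norm,
  applied to the differences (0, t - s) and (0, s - t), already forces t = s. The second is the
  sharp constant for the Euclidean norm. Bounding the components of the measure one at a time would
  lose a factor depending on n. The bound M comes from one scalar functional, which sends h to the
  supremum of \<Lambda> g over the continuous fields g with \<open>norm (g x)\<close> \<le> h x on
  the closure, where \<Lambda> is the Hahn-Banach extension. This functional is additive and
  positive on nonnegative h, its Riesz measure has mass at most M, and that measure dominates the
  norm of the vector measure on every Borel subset of the closure.\<close>

instantiation "fun" :: (type, real_vector) real_vector
begin

text \<open>Pointwise scaling makes \<open>subspace\<close> and \<open>span\<close> available for
  pairs of a field and a real number; the continuous fields will be the carrier \<open>E\<close> of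
  the extension theorem.\<close>

definition scaleR_fun :: "real \<Rightarrow> ('a \<Rightarrow> 'b) \<Rightarrow> 'a \<Rightarrow> 'b"
  where "scaleR_fun c f = (\<lambda>x. c *\<^sub>R f x)"

instance
  by standard (auto simp: scaleR_fun_def fun_eq_iff algebra_simps)

end

text \<open>Partial extensions are subspaces of the product rather than functions with a domain: the
  union of a chain is then again a subspace, and a one-dimensional extension is the sum with a span.
  Sublinearity is asked on a carrier \<open>E\<close> only, because the supremum of an unbounded
  function is unspecified.\<close>

lemma Hahn_Banach_graph:
  fixes p :: "'a::real_vector \<Rightarrow> real" and G :: "('a \<times> real) set"
  assumes E: "subspace E"
    and sub: "\<And>x y. x \<in> E \<Longrightarrow> y \<in> E \<Longrightarrow> p (x + y) \<le> p x + p y"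
    and hom: "\<And>c x. x \<in> E \<Longrightarrow> 0 < c \<Longrightarrow> p (c *\<^sub>R x) = c * p x"
    and G: "subspace G" "fst ` G \<subseteq> E" "\<And>x t. (x, t) \<in> G \<Longrightarrow> t \<le> p x"
  obtains F where "\<And>x y. x \<in> E \<Longrightarrow> y \<in> E \<Longrightarrow> F (x + y) = F x + F y"
    and "\<And>c x. x \<in> E \<Longrightarrow> F (c *\<^sub>R x) = c * F x"
    and "\<And>x t. (x, t) \<in> G \<Longrightarrow> F x = t"
    and "\<And>x. x \<in> E \<Longrightarrow> F x \<le> p x"
proof -
  define A where "A = {H. G \<subseteq> H \<and> subspace H \<and> fst ` H \<subseteq> E \<and> (\<forall>(x, t)\<in>H. t \<le> p x)}"
  have "\<exists>H\<in>A. \<forall>X\<in>A. H \<subseteq> X \<longrightarrow> X = H"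
  proof (rule subset_Zorn_nonempty)
    show "A \<noteq> {}" using G by (auto simp: A_def)
  next
    fix C assume C: "C \<noteq> {}" "subset.chain A C"
    then have CA: "H \<in> A" if "H \<in> C" for H
      using that by (auto simp: subset_chain_def)
    have "subspace (\<Union>C)"
      unfolding subspace_def
    proof (intro conjI ballI allI)
      show "0 \<in> \<Union>C"
        using C(1) CA by (force simp: A_def subspace_def)
    next
      fix u v assume "u \<in> \<Union>C" "v \<in> \<Union>C"
      then obtain H where "H \<in> C" "u \<in> H" "v \<in> H"
        using C(2) unfolding subset_chain_def by blast
      then show "u + v \<in> \<Union>C"
        using CA[of H] by (auto simp: A_def subspace_def)
    next
      fix c u assume "u \<in> \<Union>C"
      then obtain H where "H \<in> C" "u \<in> H" by blast
      then show "c *\<^sub>R u \<in> \<Union>C"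
        using CA[of H] subspace_scale[of H u c] unfolding A_def by blast
    qed
    moreover have "G \<subseteq> \<Union>C" using C(1) CA unfolding A_def by blast
    moreover have "fst ` \<Union>C \<subseteq> E" "\<forall>(x, t)\<in>\<Union>C. t \<le> p x"
      using CA unfolding A_def by (blast, blast)
    ultimately show "\<Union>C \<in> A" by (simp add: A_def)
  qed
  then obtain H where H: "H \<in> A" and max: "\<And>X. X \<in> A \<Longrightarrow> H \<subseteq> X \<Longrightarrow> X = H"
    by blast
  have HG: "G \<subseteq> H" and Hs: "subspace H" and HE: "\<And>x t. (x, t) \<in> H \<Longrightarrow> x \<in> E"
    and Hp: "\<And>x t. (x, t) \<in> H \<Longrightarrow> t \<le> p x"
    using H unfolding A_def by force+
  have H0: "(0, 0) \<in> H" using Hs by (simp add: subspace_def zero_prod_def)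
  have Hadd: "(x + y, t + s) \<in> H" if "(x, t) \<in> H" "(y, s) \<in> H" for x y t s
    using subspace_add[OF Hs that] by simp
  have Hscale: "(c *\<^sub>R x, c * t) \<in> H" if "(x, t) \<in> H" for c x t
    using subspace_scale[OF Hs that, of c] by simp
  have p0: "p 0 = 0"
    using hom[of 0 2] E by (simp add: subspace_def)
  \<comment> \<open>Two values over one point differ by an element over 0, where p vanishes;
    domination by p is what makes the relation a graph.\<close>
  have single: "t = s" if "(x, t) \<in> H" "(x, s) \<in> H" for x t s
  proof -
    have "(0, t - s) \<in> H" "(0, s - t) \<in> H"
      using Hadd[OF that(1) Hscale[OF that(2), of "-1"]] Hadd[OF that(2) Hscale[OF that(1), of "-1"]] by auto
    then show ?thesis using Hp[of 0 "t - s"] Hp[of 0 "s - t"] p0 by simp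
  qed
  have total: "\<exists>t. (x0, t) \<in> H" if x0: "x0 \<in> E" for x0
  proof -
    \<comment> \<open>A value c at \<open>x0\<close> must lie above every t - p (x - x0) and below
      every p (y + x0) - s. \<open>key\<close> compares the two families, and c is the supremum of
      the lower one.\<close>
    define L where "L = (\<lambda>(x, t). t - p (x - x0)) ` H"
    have key: "t - p (x - x0) \<le> p (y + x0) - s" if "(x, t) \<in> H" "(y, s) \<in> H" for x t y s
    proof -
      have "t + s \<le> p ((x - x0) + (y + x0))" using Hp[OF Hadd[OF that]] by simp
      also have "\<dots> \<le> p (x - x0) + p (y + x0)"
        using HE[OF that(1)] HE[OF that(2)] x0 E by (intro sub) (auto intro: subspace_diff subspace_add)
      finally show ?thesis by simp
    qed
    define c where "c = Sup L"
    have bdd: "bdd_above L" and ne: "L \<noteq> {}"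
      using key[OF _ H0] H0 by (auto simp: L_def intro!: bdd_aboveI)
    have c1: "t - p (x - x0) \<le> c" if "(x, t) \<in> H" for x t
      unfolding c_def using that by (intro cSup_upper bdd) (auto simp: L_def)
    have c2: "c \<le> p (y + x0) - s" if "(y, s) \<in> H" for y s
      unfolding c_def using key[OF _ that] by (intro cSup_least ne) (auto simp: L_def)
    define X where "X = {u + v |u v. u \<in> H \<and> v \<in> span {(x0, c)}}"
    have "subspace X" unfolding X_def by (intro subspace_sums Hs subspace_span)
    moreover have HX: "H \<subseteq> X"
      unfolding X_def using span_0[of "{(x0, c)}"] by (smt (verit, best) add.right_neutral mem_Collect_eq subsetI)
    moreover have X_elim: "x \<in> E \<and> t \<le> p x" if xtX: "(x, t) \<in> X" for x t
    proof -
      obtain y s a where ys: "(y, s) \<in> H" and xt: "x = y + a *\<^sub>R x0" "t = s + a * c"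
        using xtX unfolding X_def span_singleton by auto
      have "x \<in> E" unfolding xt
        by (intro subspace_add subspace_scale E x0 HE[OF ys])
      moreover have "t \<le> p x"
      proof -
        \<comment> \<open>Dividing by the absolute value of a reduces a > 0 to the upper bound
          \<open>c2\<close> and a < 0 to the lower bound \<open>c1\<close>.\<close>
        consider "a = 0" | "a > 0" | "a < 0" by linarith
        then show ?thesis
        proof cases
          case 1 then show ?thesis using Hp[OF ys] xt by simp
        next
          case 2
          have "c \<le> p ((1/a) *\<^sub>R y + x0) - (1/a) * s" by (rule c2[OF Hscale[OF ys]])
          then have "a * c \<le> a * (p ((1/a) *\<^sub>R y + x0) - (1/a) * s)"
            using 2 by simp
          also have "\<dots> = p (a *\<^sub>R ((1/a) *\<^sub>R y + x0)) - s"
            using 2 HE[OF ys] x0 E by (subst hom) (auto simp: algebra_simps intro: subspace_add subspace_scale)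
          also have "a *\<^sub>R ((1/a) *\<^sub>R y + x0) = x" using 2 xt by (simp add: algebra_simps)
          finally show ?thesis using xt by simp
        next
          case 3
          define b where "b = - a"
          have b: "b > 0" "a = - b" using 3 by (auto simp: b_def)
          have "(1/b) * s - p ((1/b) *\<^sub>R y - x0) \<le> c" by (rule c1[OF Hscale[OF ys]])
          then have "b * ((1/b) * s - p ((1/b) *\<^sub>R y - x0)) \<le> b * c"
            using b by simp
          moreover have "b * ((1/b) * s - p ((1/b) *\<^sub>R y - x0)) = s - p (b *\<^sub>R ((1/b) *\<^sub>R y - x0))"
            using b HE[OF ys] x0 E by (subst hom) (auto simp: algebra_simps intro: subspace_diff subspace_scale)
          moreover have "b *\<^sub>R ((1/b) *\<^sub>R y - x0) = x" using b xt by (simp add: algebra_simps)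
          ultimately show ?thesis unfolding xt(2) b(2) by simp
        qed
      qed
      ultimately show ?thesis by blast
    qed
    moreover have "G \<subseteq> X" using HG HX by blast
    ultimately have "X \<in> A" unfolding A_def by auto
    \<comment> \<open>Whether \<open>x0\<close> already has a value in H is left undecided:
      maximality gives X = H in either case, and X contains a pair over \<open>x0\<close>.\<close>
    then have "X = H" using max HX by blast
    moreover have "(x0, c) \<in> X"
      unfolding X_def using H0 span_base[of "(x0, c)" "{(x0, c)}"]
      by (intro CollectI, rule_tac exI[of _ "(0, 0)"], rule_tac exI[of _ "(x0, c)"]) simp
    ultimately show ?thesis by blast
  qed
  define F where "F x = (THE t. (x, t) \<in> H)" for x
  have F: "F x = t" if "(x, t) \<in> H" for x t
    unfolding F_def using that single by blast
  have FH: "(x, F x) \<in> H" if "x \<in> E" for x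
    using total[OF that] F by auto
  show thesis
  proof
    show "F (x + y) = F x + F y" if "x \<in> E" "y \<in> E" for x y
      by (intro F Hadd FH that)
    show "F (c *\<^sub>R x) = c * F x" if "x \<in> E" for c x
      by (intro F Hscale FH that)
    show "F x = t" if "(x, t) \<in> G" for x t
      using that HG by (intro F) auto
    show "F x \<le> p x" if "x \<in> E" for x
      by (intro Hp FH that)
  qed
qed

section \<open>Riesz representation of positive functionals on a compact set\<close>

definition cont_nonneg_on :: "'a::topological_space set \<Rightarrow> ('a \<Rightarrow> real) \<Rightarrow> bool" where
  "cont_nonneg_on K f \<longleftrightarrow> continuous_on K f \<and> (\<forall>x\<in>K. 0 \<le> f x)"

lemma set_integrable_continuous_on_compact:
  fixes h :: "'a::metric_space \<Rightarrow> real"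
  assumes "finite_measure m" and m: "sets m = sets borel" and K: "compact K" and h: "continuous_on K h"
  shows "set_integrable m K h"
proof -
  interpret finite_measure m by fact
  have Kb: "K \<in> sets borel" using compact_imp_closed[OF K] by simp
  obtain B where B: "\<And>x. x \<in> K \<Longrightarrow> norm (h x) \<le> B"
    using compact_imp_bounded[OF compact_continuous_image[OF h K]] unfolding bounded_iff by auto
  have "(\<lambda>x. indicator K x *\<^sub>R h x) \<in> borel_measurable borel"
    by (rule borel_measurable_continuous_on_indicator[OF Kb h])
  then have "(\<lambda>x. indicator K x *\<^sub>R h x) \<in> borel_measurable m"
    using m by (simp cong: measurable_cong_sets)
  then show ?thesis unfolding set_integrable_def
    using B by (intro integrable_const_bound[where B = "max B 0"]) (auto simp: indicator_def le_max_iff_disj)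
qed

lemma open_imp_ex_positivity_function:
  fixes U :: "'a::metric_space set"
  assumes "open U"
  shows "\<exists>\<phi>::'a \<Rightarrow> real. continuous_on UNIV \<phi> \<and> (\<forall>x. 0 \<le> \<phi> x) \<and> (\<forall>x. 0 < \<phi> x \<longleftrightarrow> x \<in> U)"
\<comment> \<open>The distance to the complement works unless the complement is empty, where
  \<open>infdist\<close> takes the default value 0.\<close>
proof (cases "U = UNIV")
  case True
  then show ?thesis by (intro exI[of _ "\<lambda>_. 1"]) auto
next
  case False
  have "closed (- U)" "- U \<noteq> {}" using assms False by auto
  then have "0 < infdist x (- U) \<longleftrightarrow> x \<in> U" for x
    using in_closed_iff_infdist_zero[of "- U" x] infdist_nonneg[of x "- U"] by auto
  then show ?thesis
    by (intro exI[of _ "\<lambda>x. infdist x (- U)"]) (auto intro!: continuous_intros infdist_nonneg)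
qed

text \<open>The j-th summand is the length of the part of [0, y] inside [j, j + 1].\<close>

lemma sum_unit_slices:
  fixes y :: real
  assumes "0 \<le> y"
  shows "(\<Sum>j<N. min 1 (max 0 (y - real j))) = min y (real N)"
  using assms by (induction N) (auto simp: min_def max_def)

text \<open>The bound N alongside y + 1 carries the induction: when N < y the sum grows by 1, and
  its bound N gives N + 1 \<le> y + 1.\<close>

lemma sum_indicator_less_bound:
  fixes y :: real
  assumes "0 \<le> y"
  shows "(\<Sum>j<N. if real j < y then 1 else 0) \<le> min (real N) (y + 1)"
  using assms by (induction N) (auto simp: min_def split: if_splits)

text \<open>Linearity is asked only on the cone of nonnegative functions because
  \<open>variation\<close> below, a supremum over fields of norm at most h, is meaningful only
  there.\<close>

locale positive_functional =
  fixes K :: "'a::metric_space set" and l :: "('a \<Rightarrow> real) \<Rightarrow> real"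
  assumes compact_K: "compact K"
    and add: "\<And>f g. cont_nonneg_on K f \<Longrightarrow> cont_nonneg_on K g \<Longrightarrow> l (\<lambda>x. f x + g x) = l f + l g"
    and scale: "\<And>c f. cont_nonneg_on K f \<Longrightarrow> 0 \<le> c \<Longrightarrow> l (\<lambda>x. c * f x) = c * l f"
    and nonneg: "\<And>f. cont_nonneg_on K f \<Longrightarrow> 0 \<le> l f"
begin

lemma mono:
  assumes "cont_nonneg_on K f" "cont_nonneg_on K g" "\<And>x. x \<in> K \<Longrightarrow> f x \<le> g x"
  shows "l f \<le> l g"
proof -
  have d: "cont_nonneg_on K (\<lambda>x. g x - f x)"
    using assms by (auto simp: cont_nonneg_on_def intro!: continuous_intros)
  have "l (\<lambda>x. f x + (g x - f x)) = l f + l (\<lambda>x. g x - f x)"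
    by (rule add[OF assms(1) d])
  then show ?thesis using nonneg[OF d] by simp
qed

text \<open>The functional acts on total functions. That it ignores values off K is a consequence of
  positivity: both differences of f and g are nonnegative on K.\<close>

lemma cong:
  assumes "cont_nonneg_on K f" "\<And>x. x \<in> K \<Longrightarrow> f x = g x"
  shows "l f = l g"
proof -
  have "cont_nonneg_on K g"
    using assms continuous_on_cong[of K K f g] by (auto simp: cont_nonneg_on_def)
  then show ?thesis using mono[of f g] mono[of g f] assms by force
qed

lemma zero: "l (\<lambda>_. 0) = 0"
  using scale[of "\<lambda>_. 0" 0] by (simp add: cont_nonneg_on_def)

lemma sum:
  assumes "finite J" "\<And>j. j \<in> J \<Longrightarrow> cont_nonneg_on K (f j)"
  shows "l (\<lambda>x. \<Sum>j\<in>J. f j x) = (\<Sum>j\<in>J. l (f j))"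
  using assms
proof (induction J rule: finite_induct)
  case empty
  then show ?case by (simp add: zero)
next
  case (insert j J)
  have "cont_nonneg_on K (\<lambda>x. \<Sum>j\<in>J. f j x)"
    using insert.prems by (auto simp: cont_nonneg_on_def intro!: continuous_intros sum_nonneg)
  then show ?case using insert by (simp add: add)
qed

section \<open>Content of open sets and the outer content it induces\<close>

definition mass :: real where "mass = l (\<lambda>_. 1)"

lemma mass_nonneg: "0 \<le> mass"
  unfolding mass_def by (intro nonneg) (auto simp: cont_nonneg_on_def)

text \<open>Competitors only vanish on K outside U; compact support inside U is not imposed. Where
  it matters, \<open>truncate\<close> supplies it.\<close>

definition test_functions :: "'a set \<Rightarrow> ('a \<Rightarrow> real) set" where
  "test_functions U = {h. cont_nonneg_on K h \<and> (\<forall>x\<in>K. h x \<le> 1) \<and> (\<forall>x\<in>K - U. h x = 0)}"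

definition open_content :: "'a set \<Rightarrow> ennreal" where
  "open_content U = (SUP h\<in>test_functions U. ennreal (l h))"

definition outer_content :: "'a set \<Rightarrow> ennreal" where
  "outer_content E = (INF U\<in>{U. open U \<and> E \<subseteq> U}. open_content U)"

lemma test_functionsD:
  assumes "h \<in> test_functions U"
  shows "cont_nonneg_on K h" "continuous_on K h" "\<And>x. x \<in> K \<Longrightarrow> 0 \<le> h x" "\<And>x. x \<in> K \<Longrightarrow> h x \<le> 1"
    "\<And>x. x \<in> K \<Longrightarrow> x \<notin> U \<Longrightarrow> h x = 0"
  using assms by (auto simp: test_functions_def cont_nonneg_on_def)

lemma zero_test_function: "(\<lambda>_. 0) \<in> test_functions U"
  by (auto simp: test_functions_def cont_nonneg_on_def)

lemma open_content_upper: "h \<in> test_functions U \<Longrightarrow> ennreal (l h) \<le> open_content U"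
  unfolding open_content_def by (rule SUP_upper)

lemma open_content_mono: "U \<subseteq> V \<Longrightarrow> open_content U \<le> open_content V"
  unfolding open_content_def by (intro SUP_subset_mono) (auto simp: test_functions_def)

lemma outer_content_open: "open U \<Longrightarrow> outer_content U = open_content U"
  unfolding outer_content_def
  by (intro antisym INF_lower INF_greatest) (auto intro: open_content_mono)

lemma outer_content_upper: "open U \<Longrightarrow> E \<subseteq> U \<Longrightarrow> outer_content E \<le> open_content U"
  unfolding outer_content_def by (intro INF_lower) auto

lemma outer_content_mono: "E \<subseteq> F \<Longrightarrow> outer_content E \<le> outer_content F"
  unfolding outer_content_def by (intro INF_superset_mono) auto

lemma open_content_le_mass: "open_content U \<le> ennreal mass"
  unfolding open_content_def
proof (rule SUP_least)
  fix h assume h: "h \<in> test_functions U"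
  then have "l h \<le> mass"
    unfolding mass_def by (intro mono) (auto simp: test_functions_def cont_nonneg_on_def)
  then show "ennreal (l h) \<le> ennreal mass" by (rule ennreal_leI)
qed

lemma outer_content_finite: "outer_content E < top"
proof -
  have "outer_content E \<le> open_content UNIV" by (intro outer_content_upper) auto
  also have "\<dots> \<le> ennreal mass" by (rule open_content_le_mass)
  finally show ?thesis using ennreal_less_top le_less_trans by blast
qed

lemma open_content_UNIV: "open_content UNIV = ennreal mass"
proof (rule antisym[OF open_content_le_mass])
  show "ennreal mass \<le> open_content UNIV"
    unfolding mass_def by (rule open_content_upper) (auto simp: test_functions_def cont_nonneg_on_def)
qed

lemma open_content_eq_0:
  assumes "U \<inter> K = {}"
  shows "open_content U = 0"
proof -
  have "ennreal (l h) \<le> 0" if "h \<in> test_functions U" for h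
  proof -
    have "l (\<lambda>_. 0) = l h"
      using test_functionsD[OF that] assms by (intro cong) (auto simp: cont_nonneg_on_def)
    then show ?thesis using zero by simp
  qed
  then have "open_content U \<le> 0" unfolding open_content_def by (rule SUP_least)
  then show ?thesis by simp
qed

text \<open>Since h \<le> max 0 (h - e) + e on K, cutting off costs at most \<open>e * mass\<close>.
  The truncated function vanishes on K outside the set where e \<le> h, which for e > 0 is a compact
  subset of U.\<close>

lemma truncate:
  assumes h: "h \<in> test_functions U" and e: "0 \<le> e"
  shows "(\<lambda>x. max 0 (h x - e)) \<in> test_functions U" (is "?h' \<in> _")
    and "l h \<le> l (\<lambda>x. max 0 (h x - e)) + e * mass"
proof -
  note hD = test_functionsD[OF h]
  show h': "?h' \<in> test_functions U"
    using hD e by (fastforce simp: test_functions_def cont_nonneg_on_def intro!: continuous_intros)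
  have "l h \<le> l (\<lambda>x. ?h' x + e * 1)"
    using hD e by (intro mono) (auto simp: cont_nonneg_on_def intro!: continuous_intros)
  also have "\<dots> = l ?h' + l (\<lambda>x. e * 1)"
    using test_functionsD[OF h'] e by (intro add) (auto simp: cont_nonneg_on_def)
  also have "l (\<lambda>x. e * 1) = e * mass"
    unfolding mass_def using e by (intro scale) (auto simp: cont_nonneg_on_def)
  finally show "l h \<le> l ?h' + e * mass" .
qed

lemma superlevel_compact:
  assumes "continuous_on K h"
  shows "compact {x\<in>K. e \<le> (h x :: real)}"
proof -
  have "closedin (top_of_set K) (K \<inter> h -` {e..})"
    by (rule continuous_closedin_preimage[OF assms]) simp
  moreover have "K \<inter> h -` {e..} = {x\<in>K. e \<le> h x}" by auto
  ultimately show ?thesis using compact_K closedin_compact by metis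
qed

text \<open>A partition of unity on the compact superlevel set of a test function splits it along
  finitely many of the open sets.\<close>
lemma open_content_UN_le:
  fixes U :: "nat \<Rightarrow> 'a set"
  assumes U: "\<And>n. open (U n)"
  shows "open_content (\<Union>n. U n) \<le> (\<Sum>n. open_content (U n))"
proof -
  have approx: "ennreal (l h) \<le> (\<Sum>n. open_content (U n)) + ennreal \<epsilon>"
    if h: "h \<in> test_functions (\<Union>n. U n)" and "0 < \<epsilon>" for h \<epsilon>
  proof -
    note hD = test_functionsD[OF h]
    \<comment> \<open>Chosen to make the truncation error \<open>e * mass\<close> at most
      \<epsilon>; the summand 1 guards against mass 0.\<close>
    define e where "e = \<epsilon> / (mass + 1)"
    have e: "0 < e" "e * mass \<le> \<epsilon>"
      using \<open>0 < \<epsilon>\<close> mass_nonneg by (auto simp: e_def field_simps)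
    define h' where "h' = (\<lambda>x. max 0 (h x - e))"
    have h': "h' \<in> test_functions (\<Union>n. U n)" "l h \<le> l h' + e * mass"
      using truncate[OF h, of e] e by (auto simp: h'_def)
    note h'D = test_functionsD[OF h'(1)]
    define S where "S = {x\<in>K. e \<le> h x}"
    have S: "compact S" unfolding S_def by (intro superlevel_compact hD)
    have "S \<subseteq> (\<Union>n. U n)" using hD(5) e by (force simp: S_def)
    then obtain J where J: "finite J" "S \<subseteq> (\<Union>n\<in>J. U n)"
      using compactE_image[OF S, of UNIV U] U by auto
    have "\<forall>n. \<exists>\<phi>::'a \<Rightarrow> real. continuous_on UNIV \<phi> \<and> (\<forall>x. 0 \<le> \<phi> x) \<and> (\<forall>x. 0 < \<phi> x \<longleftrightarrow> x \<in> U n)"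
      using open_imp_ex_positivity_function U by blast
    then obtain \<phi> :: "nat \<Rightarrow> 'a \<Rightarrow> real" where \<phi>: "\<And>n. continuous_on UNIV (\<phi> n)" "\<And>n x. 0 \<le> \<phi> n x"
      "\<And>n x. 0 < \<phi> n x \<longleftrightarrow> x \<in> U n"
      by metis
    have \<phi>K: "continuous_on K (\<phi> n)" for n using \<phi>(1) continuous_on_subset by blast
    define P where "P x = (\<Sum>n\<in>J. \<phi> n x)" for x
    have Pc: "continuous_on A P" for A
      unfolding P_def by (intro continuous_on_sum continuous_on_subset[OF \<phi>(1)]) auto
    have Ppos: "0 < P x" if xS: "x \<in> S" for x
    proof -
      obtain n where n: "n \<in> J" "x \<in> U n" using xS J(2) by blast
      then show ?thesis
        unfolding P_def using \<phi>(2) \<phi>(3)[of n x] by (intro sum_pos2[OF J(1) n(1)]) auto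
    qed
    \<comment> \<open>P is bounded below by some d > 0 on the compact S, so max (P x) d is a
      denominator that is positive everywhere and equals P on S. Outside S the numerator
      \<open>h'\<close> vanishes.\<close>
    obtain d where d: "0 < d" "\<And>x. x \<in> S \<Longrightarrow> d \<le> P x"
    proof (cases "S = {}")
      case True then show ?thesis using that[of 1] by auto
    next
      case False
      then obtain z where "z \<in> S" "\<And>x. x \<in> S \<Longrightarrow> P z \<le> P x"
        using continuous_attains_inf[OF S _ Pc] by blast
      then show ?thesis using that[of "P z"] Ppos by auto
    qed
    have Pd: "0 < max (P x) d" for x using d by auto
    define k where "k n x = h' x * (\<phi> n x / max (P x) d)" for n x
    have k: "k n \<in> test_functions (U n)" if "n \<in> J" for n
    proof -
      have "continuous_on K (k n)"
        unfolding k_def using Pd by (intro continuous_intros h'D \<phi>K Pc) (auto simp: less_le)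
      moreover have "0 \<le> k n x" "k n x \<le> 1" if "x \<in> K" for x
      proof -
        show "0 \<le> k n x" using h'D(3)[OF that] \<phi>(2) Pd[of x] by (simp add: k_def)
        have "\<phi> n x \<le> P x" unfolding P_def by (rule member_le_sum[OF \<open>n \<in> J\<close> \<phi>(2) J(1)])
        then have "\<phi> n x / max (P x) d \<le> 1" using Pd[of x] by (simp add: divide_le_eq)
        then show "k n x \<le> 1"
          unfolding k_def using h'D(3,4)[OF that] \<phi>(2) Pd[of x] by (intro mult_le_one) auto
      qed
      moreover have "k n x = 0" if "x \<notin> U n" for x
        using \<phi>(2,3)[of n x] that by (simp add: k_def)
      ultimately show ?thesis by (auto simp: test_functions_def cont_nonneg_on_def)
    qed
    have "l h' = l (\<lambda>x. \<Sum>n\<in>J. k n x)"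
    proof (rule cong[OF h'D(1)])
      fix x assume "x \<in> K"
      have *: "(\<Sum>n\<in>J. k n x) = h' x * (P x / max (P x) d)"
        by (simp add: k_def P_def sum_distrib_left sum_divide_distrib)
      show "h' x = (\<Sum>n\<in>J. k n x)"
      proof (cases "x \<in> S")
        case True
        then show ?thesis unfolding * using d(2)[OF True] d(1) by (simp add: max_def)
      next
        case False
        then have "h' x = 0" using \<open>x \<in> K\<close> by (auto simp: h'_def S_def)
        then show ?thesis unfolding * by simp
      qed
    qed
    also have "\<dots> = (\<Sum>n\<in>J. l (k n))"
      using k J by (intro sum) (auto simp: test_functions_def)
    finally have "ennreal (l h') = (\<Sum>n\<in>J. ennreal (l (k n)))"
      using nonneg[OF test_functionsD(1)[OF k]] by (simp add: sum_ennreal)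
    also have "\<dots> \<le> (\<Sum>n\<in>J. open_content (U n))"
      by (intro sum_mono open_content_upper k)
    also have "\<dots> \<le> (\<Sum>n. open_content (U n))"
      using J by (intro sum_le_suminf) auto
    finally have *: "ennreal (l h') \<le> (\<Sum>n. open_content (U n))" .
    have "ennreal (l h) \<le> ennreal (l h' + \<epsilon>)"
      using h'(2) e by (intro ennreal_leI) linarith
    also have "\<dots> = ennreal (l h') + ennreal \<epsilon>"
      using nonneg[OF h'D(1)] \<open>0 < \<epsilon>\<close> by (intro ennreal_plus) auto
    finally show ?thesis using * by (meson add_right_mono order_trans)
  qed
  have "ennreal (l h) \<le> (\<Sum>n. open_content (U n))" if "h \<in> test_functions (\<Union>n. U n)" for h
    by (rule ennreal_le_epsilon) (rule approx[OF that])
  then show ?thesis unfolding open_content_def[of "\<Union>n. U n"] by (rule SUP_least)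
qed

lemma outer_content_UN_le:
  fixes A :: "nat \<Rightarrow> 'a set"
  shows "outer_content (\<Union>n. A n) \<le> (\<Sum>n. outer_content (A n))"
proof (rule ennreal_le_epsilon)
  fix e :: real assume "0 < e"
  have "\<exists>U\<in>{U. open U \<and> A n \<subseteq> U}. open_content U < outer_content (A n) + ennreal (e * (1/2)^Suc n)" for n
    using outer_content_finite[of "A n"] \<open>0 < e\<close>
    by (intro INF_approx_ennreal[OF _ outer_content_def]) auto
  then obtain U where U: "\<And>n. open (U n)" "\<And>n. A n \<subseteq> U n"
    "\<And>n. open_content (U n) < outer_content (A n) + ennreal (e * (1/2)^Suc n)"
    by (simp add: Bex_def) metis
  have "outer_content (\<Union>n. A n) \<le> open_content (\<Union>n. U n)"
    by (intro outer_content_upper open_UN ballI UN_mono U) auto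
  also have "\<dots> \<le> (\<Sum>n. open_content (U n))" by (intro open_content_UN_le U)
  also have "\<dots> \<le> (\<Sum>n. outer_content (A n) + ennreal (e * (1/2) ^ Suc n))"
    using U(3) by (intro suminf_le) (auto intro: less_imp_le)
  also have "\<dots> = (\<Sum>n. outer_content (A n)) + (\<Sum>n. ennreal (e * (1/2) ^ Suc n))"
    by (rule suminf_add[symmetric]) (rule summableI)+
  also have "(\<Sum>n. ennreal (e * (1/2) ^ Suc n)) = ennreal e"
    using sums_mult[OF power_half_series, of e] \<open>0 < e\<close> by (intro suminf_ennreal_eq) auto
  finally show "outer_content (\<Union>n. A n) \<le> (\<Sum>n. outer_content (A n)) + ennreal e" .
qed

section \<open>Caratheodory measurability of open sets\<close>

lemma outer_measure_space_outer_content: "outer_measure_space UNIV outer_content"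
proof -
  have "outer_content {} = 0"
    using outer_content_open[of "{}"] open_content_eq_0[of "{}"] by simp
  then show ?thesis
    by (auto simp: outer_measure_space_def positive_def increasing_def countably_subadditive_def
        intro: outer_content_mono outer_content_UN_le)
qed

text \<open>A truncated test function for V \<inter> U lives on a compact S inside U, and a test
  function for V - S vanishes on S. Their sum therefore stays below 1 and is a test function for V,
  while V - S is an open set containing E - U.\<close>

lemma open_content_split:
  assumes "open U" "open V" "E \<subseteq> V"
  shows "open_content (V \<inter> U) + outer_content (E - U) \<le> open_content V"
proof -
  have approx: "ennreal (l h) + outer_content (E - U) \<le> open_content V + ennreal \<epsilon>"
    if h: "h \<in> test_functions (V \<inter> U)" and "0 < \<epsilon>" for h \<epsilon>
  proof -
    note hD = test_functionsD[OF h]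
    define e where "e = \<epsilon> / (mass + 1)"
    have e: "0 < e" "e * mass \<le> \<epsilon>"
      using \<open>0 < \<epsilon>\<close> mass_nonneg by (auto simp: e_def field_simps)
    define h' where "h' = (\<lambda>x. max 0 (h x - e))"
    have h': "h' \<in> test_functions (V \<inter> U)" "l h \<le> l h' + e * mass"
      using truncate[OF h, of e] e by (auto simp: h'_def)
    note h'D = test_functionsD[OF h'(1)]
    define S where "S = {x\<in>K. e \<le> h x}"
    have "closed S" unfolding S_def by (intro compact_imp_closed superlevel_compact hD)
    then have W: "open (V - S)" using assms by (intro open_Diff)
    have "E - U \<subseteq> V - S" using assms(3) hD(5) e by (force simp: S_def)
    then have "outer_content (E - U) \<le> open_content (V - S)" by (intro outer_content_upper W)
    then have "ennreal (l h) + outer_content (E - U) \<le> ennreal (l h) + open_content (V - S)"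
      by (intro add_left_mono)
    also have "\<dots> = (SUP k\<in>test_functions (V - S). ennreal (l h) + ennreal (l k))"
      unfolding open_content_def using zero_test_function by (intro ennreal_SUP_add_right) auto
    also have "\<dots> \<le> open_content V + ennreal \<epsilon>"
    proof (rule SUP_least)
      fix k assume k: "k \<in> test_functions (V - S)"
      note kD = test_functionsD[OF k]
      have "h' x + k x \<le> 1" if "x \<in> K" for x
        using that kD(4,5)[OF that] h'D(4)[OF that] by (cases "x \<in> S") (auto simp: h'_def S_def)
      then have hk: "(\<lambda>x. h' x + k x) \<in> test_functions V"
        using kD h'D by (auto simp: test_functions_def cont_nonneg_on_def intro!: continuous_intros)
      have "l h + l k \<le> l (\<lambda>x. h' x + k x) + \<epsilon>"
        using h'(2) e add[OF h'D(1) kD(1)] by linarith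
      then have "ennreal (l h + l k) \<le> ennreal (l (\<lambda>x. h' x + k x) + \<epsilon>)" by (rule ennreal_leI)
      also have "\<dots> = ennreal (l (\<lambda>x. h' x + k x)) + ennreal \<epsilon>"
        using nonneg[OF test_functionsD(1)[OF hk]] \<open>0 < \<epsilon>\<close> by (intro ennreal_plus) auto
      also have "\<dots> \<le> open_content V + ennreal \<epsilon>"
        by (intro add_right_mono open_content_upper hk)
      finally show "ennreal (l h) + ennreal (l k) \<le> open_content V + ennreal \<epsilon>"
        using nonneg[OF hD(1)] nonneg[OF kD(1)] by simp
    qed
    finally show ?thesis .
  qed
  have "ennreal (l h) + outer_content (E - U) \<le> open_content V"
    if "h \<in> test_functions (V \<inter> U)" for h
    by (rule ennreal_le_epsilon) (rule approx[OF that])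
  then have "(SUP h\<in>test_functions (V \<inter> U). ennreal (l h) + outer_content (E - U)) \<le> open_content V"
    by (rule SUP_least)
  moreover have "(SUP h\<in>test_functions (V \<inter> U). ennreal (l h) + outer_content (E - U))
      = open_content (V \<inter> U) + outer_content (E - U)"
    unfolding open_content_def using zero_test_function by (intro ennreal_SUP_add_left) auto
  ultimately show ?thesis by simp
qed

text \<open>The inequality that is not subadditivity is \<open>open_content_split\<close>, minimised
  over the open sets V containing E.\<close>

lemma open_in_lambda_system:
  assumes "open U"
  shows "U \<in> lambda_system UNIV UNIV outer_content"
proof -
  have sub: "subadditive UNIV outer_content"
    using ring_of_sets.countably_subadditive_subadditive[OF ring_of_sets_Pow, of UNIV outer_content]
      outer_measure_space_outer_content by (simp add: outer_measure_space_def)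
  have "outer_content (U \<inter> E) + outer_content ((UNIV - U) \<inter> E) = outer_content E" for E
  proof (rule antisym)
    have "(UNIV - U) \<inter> E = E - U" by auto
    moreover have "outer_content (U \<inter> E) + outer_content (E - U) \<le> open_content V"
      if "V \<in> {V. open V \<and> E \<subseteq> V}" for V
    proof -
      have "outer_content (U \<inter> E) \<le> open_content (V \<inter> U)"
        using that assms by (intro outer_content_upper) auto
      then show ?thesis
        using open_content_split[of U V E] assms that by (auto intro: order_trans add_right_mono)
    qed
    then have "outer_content (U \<inter> E) + outer_content (E - U) \<le> outer_content E"
      unfolding outer_content_def[of E] by (rule INF_greatest)
    ultimately show "outer_content (U \<inter> E) + outer_content ((UNIV - U) \<inter> E) \<le> outer_content E"
      by simp
    have "outer_content ((U \<inter> E) \<union> ((UNIV - U) \<inter> E)) \<le> outer_content (U \<inter> E) + outer_content ((UNIV - U) \<inter> E)"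
      by (intro subadditiveD[OF sub]) auto
    moreover have "(U \<inter> E) \<union> ((UNIV - U) \<inter> E) = E" by auto
    ultimately show "outer_content E \<le> outer_content (U \<inter> E) + outer_content ((UNIV - U) \<inter> E)" by simp
  qed
  then show ?thesis by (simp add: lambda_system_def)
qed

section \<open>The Borel measure and its integral\<close>

definition riesz_measure :: "'a measure" where
  "riesz_measure = measure_of UNIV (sets borel) outer_content"

lemma sets_riesz_measure [simp]: "sets riesz_measure = sets borel"
  using sets.sets_measure_of_eq[of borel] by (simp add: riesz_measure_def)

lemma space_riesz_measure [simp]: "space riesz_measure = UNIV"
  using sets_eq_imp_space_eq[OF sets_riesz_measure] by simp

text \<open>\<open>measure_of\<close> returns the given set function only if it is a measure.
  Caratheodory provides this on the lambda system, which contains the open sets and hence the Borel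
  sets.\<close>

lemma emeasure_riesz_measure:
  assumes "A \<in> sets borel"
  shows "emeasure riesz_measure A = outer_content A"
proof -
  have L: "measure_space UNIV (lambda_system UNIV UNIV outer_content) outer_content"
    using sigma_algebra.caratheodory_lemma[OF sigma_algebra_Pow, of UNIV outer_content]
      outer_measure_space_outer_content by simp
  then have "sigma_sets UNIV (Collect open) \<subseteq> lambda_system UNIV UNIV outer_content"
    by (intro sigma_algebra.sigma_sets_subset) (auto simp: measure_space_def open_in_lambda_system)
  then have "sets borel \<subseteq> lambda_system UNIV UNIV outer_content"
    by (simp add: sets_borel)
  moreover have sa: "sigma_algebra UNIV (sets (borel :: 'a measure))"
    using sets.sigma_algebra_axioms[of "borel :: 'a measure"] by simp
  ultimately have "measure_space UNIV (sets borel) outer_content"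
    by (intro measure_down[OF L])
  then show ?thesis
    unfolding riesz_measure_def
    by (intro emeasure_measure_of_sigma assms) (auto simp: measure_space_def)
qed

lemma finite_measure_riesz_measure: "finite_measure riesz_measure"
  using outer_content_finite[of UNIV] by (intro finite_measureI) (simp add: emeasure_riesz_measure less_top)

lemma measure_riesz_measure_UNIV: "measure riesz_measure UNIV = mass"
  using mass_nonneg by (simp add: measure_def emeasure_riesz_measure outer_content_open open_content_UNIV)

lemma emeasure_riesz_measure_Compl: "emeasure riesz_measure (UNIV - K) = 0"
  using compact_imp_closed[OF compact_K]
  by (subst emeasure_riesz_measure)
     (auto simp: outer_content_open open_Diff intro!: open_content_eq_0)

lemma set_integrable_riesz_measure:
  assumes "continuous_on K (h :: 'a \<Rightarrow> real)"
  shows "set_integrable riesz_measure K h"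
  by (rule set_integrable_continuous_on_compact[OF finite_measure_riesz_measure _ compact_K assms]) simp

text \<open>Slicing h into N layers of height 1/N compares it with the measures of its superlevel sets.\<close>
lemma functional_le_integral:
  assumes h: "cont_nonneg_on K h" and h1: "\<And>x. x \<in> K \<Longrightarrow> h x \<le> 1"
  shows "l h \<le> (LINT x:K|riesz_measure. h x)"
proof -
  interpret finite_measure riesz_measure by (rule finite_measure_riesz_measure)
  have hc: "continuous_on K h" and h0: "\<And>x. x \<in> K \<Longrightarrow> 0 \<le> h x"
    using h by (auto simp: cont_nonneg_on_def)
  define f where "f x = indicator K x * h x" for x
  have fi: "integrable riesz_measure f"
    using set_integrable_riesz_measure[OF hc] by (simp add: set_integrable_def f_def[abs_def])
  have f0: "0 \<le> f x" for x using h0 by (simp add: f_def indicator_def)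
  have bound: "l h \<le> integral\<^sup>L riesz_measure f + mass / real N" if N: "0 < N" for N
  proof -
    define k where "k j x = min 1 (max 0 (real N * h x - real j))" for j x
    have kc: "cont_nonneg_on K (k j)" for j
      unfolding k_def cont_nonneg_on_def by (auto intro!: continuous_intros hc)
    define A where "A j = {x. real j < real N * f x}" for j
    have A: "A j \<in> sets borel" for j
    proof -
      have "{x\<in>space riesz_measure. real j < real N * f x} \<in> sets riesz_measure"
        using borel_measurable_integrable[OF fi] by measurable
      then show ?thesis by (simp add: A_def)
    qed
    have Ai: "integrable riesz_measure (indicat_real (A j))" for j
      using A by (intro integrable_real_indicator) (auto simp: emeasure_eq_measure)
    have "l (k j) \<le> measure riesz_measure (A j)" for j
    proof -
      have "ennreal (l (k j)) \<le> outer_content (A j)"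
        unfolding outer_content_def
      proof (rule INF_greatest)
        fix U assume "U \<in> {U. open U \<and> A j \<subseteq> U}"
        then have "A j \<subseteq> U" by simp
        then have "k j x = 0" if "x \<in> K - U" for x
          using that by (force simp: A_def k_def f_def)
        then show "ennreal (l (k j)) \<le> open_content U"
          using kc[of j] by (intro open_content_upper) (auto simp: test_functions_def k_def)
      qed
      then show ?thesis
        using emeasure_riesz_measure[OF A, of j]
        by (metis emeasure_eq_measure ennreal_le_iff measure_nonneg)
    qed
    then have "(\<Sum>j<N. l (k j)) \<le> (\<Sum>j<N. measure riesz_measure (A j))" by (rule sum_mono)
    also have "\<dots> = integral\<^sup>L riesz_measure (\<lambda>x. \<Sum>j<N. indicator (A j) x)"
      using Ai by (subst Bochner_Integration.integral_sum) auto
    \<comment> \<open>Counting the levels below N f overshoots N f by at most 1. Integrated, this is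
      the error \<open>mass\<close>, which becomes \<open>mass / N\<close> after division by
      N.\<close>
    also have "\<dots> \<le> integral\<^sup>L riesz_measure (\<lambda>x. real N * f x + 1)"
    proof (rule integral_mono)
      fix x
      have "(\<Sum>j<N. indicat_real (A j) x) = (\<Sum>j<N. if real j < real N * f x then 1 else 0)"
        by (intro sum.cong) (auto simp: A_def)
      then show "(\<Sum>j<N. indicat_real (A j) x) \<le> real N * f x + 1"
        using sum_indicator_less_bound[of "real N * f x" N] f0[of x] by simp
    qed (use fi Ai in auto)
    also have "\<dots> = real N * integral\<^sup>L riesz_measure f + mass"
      using fi by (simp add: measure_riesz_measure_UNIV)
    finally have *: "(\<Sum>j<N. l (k j)) \<le> real N * integral\<^sup>L riesz_measure f + mass" .
    have "real N * l h = l (\<lambda>x. real N * h x)" using scale[OF h, of "real N"] by simp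
    also have "\<dots> = l (\<lambda>x. \<Sum>j<N. k j x)"
    proof (rule cong)
      show "cont_nonneg_on K (\<lambda>x. real N * h x)"
        using hc h0 by (auto simp: cont_nonneg_on_def intro!: continuous_intros)
      show "real N * h x = (\<Sum>j<N. k j x)" if "x \<in> K" for x
      proof -
        have "real N * h x \<le> real N" using h1[OF that] by (simp add: mult_left_le)
        then show ?thesis using sum_unit_slices[of "real N * h x" N] h0[OF that] by (simp add: k_def)
      qed
    qed
    also have "\<dots> = (\<Sum>j<N. l (k j))" using kc by (intro sum) auto
    finally have "real N * l h \<le> real N * integral\<^sup>L riesz_measure f + mass" using * by simp
    then show ?thesis using N by (simp add: field_simps)
  qed
  have "l h \<le> integral\<^sup>L riesz_measure f"
  proof (rule LIMSEQ_le_const)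
    have "(\<lambda>N. integral\<^sup>L riesz_measure f + mass * (1 / real N)) \<longlonglongrightarrow> integral\<^sup>L riesz_measure f + mass * 0"
      by (intro tendsto_intros lim_1_over_n)
    then show "(\<lambda>N. integral\<^sup>L riesz_measure f + mass / real N) \<longlonglongrightarrow> integral\<^sup>L riesz_measure f" by simp
    show "\<exists>N. \<forall>n\<ge>N. l h \<le> integral\<^sup>L riesz_measure f + mass / real n"
      using bound by (intro exI[of _ 1]) auto
  qed
  then show ?thesis by (simp add: set_lebesgue_integral_def f_def[abs_def])
qed

text \<open>For h \<le> 1 the inequality already proved, applied to 1 - h, is the reverse
  inequality, because K carries exactly the mass l 1. Scaling reduces a general h to this
  case.\<close>

theorem Riesz_representation:
  assumes h: "cont_nonneg_on K h"
  shows "l h = (LINT x:K|riesz_measure. h x)"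
proof -
  interpret finite_measure riesz_measure by (rule finite_measure_riesz_measure)
  have unit: "l h = (LINT x:K|riesz_measure. h x)"
    if h: "cont_nonneg_on K h" and h1: "\<And>x. x \<in> K \<Longrightarrow> h x \<le> 1" for h
  proof (rule antisym[OF functional_le_integral[OF h h1]])
    have hc: "continuous_on K h" using h by (simp add: cont_nonneg_on_def)
    have h': "cont_nonneg_on K (\<lambda>x. 1 - h x)"
      using h h1 by (auto simp: cont_nonneg_on_def intro!: continuous_intros)
    have Kb: "K \<in> sets borel" using compact_imp_closed[OF compact_K] by simp
    have "measure riesz_measure K = measure riesz_measure UNIV"
      using emeasure_riesz_measure_Compl Kb finite_measure_compl[of K]
      by (simp add: measure_def)
    then have mK: "measure riesz_measure K = mass" by (simp add: measure_riesz_measure_UNIV)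
    have "mass - l h = l (\<lambda>x. 1 - h x)"
      using add[OF h h'] by (simp add: mass_def)
    also have "\<dots> \<le> (LINT x:K|riesz_measure. 1 - h x)"
      using h' h by (intro functional_le_integral) (auto simp: cont_nonneg_on_def)
    also have "\<dots> = (LINT x:K|riesz_measure. 1) - (LINT x:K|riesz_measure. h x)"
      by (intro set_integral_diff set_integrable_riesz_measure hc) auto
    also have "(LINT x:K|riesz_measure. 1) = mass"
      using Kb by (simp add: set_lebesgue_integral_def mK)
    finally show "(LINT x:K|riesz_measure. h x) \<le> l h" by simp
  qed
  have hc: "continuous_on K h" and h0: "\<And>x. x \<in> K \<Longrightarrow> 0 \<le> h x"
    using h by (auto simp: cont_nonneg_on_def)
  obtain B where "\<And>x. x \<in> K \<Longrightarrow> norm (h x) \<le> B"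
    using compact_imp_bounded[OF compact_continuous_image[OF hc compact_K]] unfolding bounded_iff by auto
  then have B: "\<And>x. x \<in> K \<Longrightarrow> h x \<le> max B 1" by force
  define c where "c = max B 1"
  have c: "0 < c" by (simp add: c_def)
  have "cont_nonneg_on K (\<lambda>x. (1/c) * h x)"
    using hc h0 c by (auto simp: cont_nonneg_on_def intro!: continuous_intros)
  then have "l (\<lambda>x. (1/c) * h x) = (LINT x:K|riesz_measure. (1/c) * h x)"
    using B c by (intro unit) (auto simp: c_def)
  then have "(1/c) * l h = (1/c) * (LINT x:K|riesz_measure. h x)"
    using scale[OF h, of "1/c"] c by (simp only: set_integral_mult_right) simp
  then show ?thesis using c by simp
qed

end

section \<open>Riesz representation of vector functionals\<close>

text \<open>The cutoffs decrease to the indicator of the closed set C, which lets bounds on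
  integrals of continuous functions pass to measures of compact sets. C is nonempty because
  \<open>infdist\<close> to the empty set is 0, which would make every cutoff 1.\<close>

lemma LIMSEQ_cutoff_integral:
  fixes m :: "'a::metric_space measure"
  assumes "finite_measure m" and m: "sets m = sets borel" and K: "compact K"
    and C: "compact C" "C \<subseteq> K" "C \<noteq> {}"
  shows "(\<lambda>j. LINT x:K|m. max 0 (1 - real j * infdist x C)) \<longlonglongrightarrow> measure m C"
proof -
  interpret finite_measure m by fact
  have Kb: "K \<in> sets m" and Cb: "C \<in> sets m"
    using compact_imp_closed[OF K] compact_imp_closed[OF C(1)] m by auto
  have "(\<lambda>j. integral\<^sup>L m (\<lambda>x. indicator K x *\<^sub>R max 0 (1 - real j * infdist x C))) \<longlonglongrightarrow> integral\<^sup>L m (indicat_real C)"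
  proof (rule integral_dominated_convergence[where w = "\<lambda>_. 1"])
    show "(\<lambda>x. indicator K x *\<^sub>R max 0 (1 - real j * infdist x C)) \<in> borel_measurable m" for j
    proof -
      have "(\<lambda>x. indicator K x *\<^sub>R max 0 (1 - real j * infdist x C)) \<in> borel_measurable borel"
        using Kb m by (intro borel_measurable_continuous_on_indicator) (auto intro!: continuous_intros)
      then show ?thesis using m by (simp cong: measurable_cong_sets)
    qed
    show "AE x in m. (\<lambda>j. indicator K x *\<^sub>R max 0 (1 - real j * infdist x C)) \<longlonglongrightarrow> indicat_real C x"
    proof (rule AE_I2)
      fix x
      show "(\<lambda>j. indicator K x *\<^sub>R max 0 (1 - real j * infdist x C)) \<longlonglongrightarrow> indicat_real C x"
      proof (cases "x \<in> C")
        case True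
        then show ?thesis using C by auto
      next
        case False
        then have d: "0 < infdist x C"
          using C compact_imp_closed by (intro infdist_pos_not_in_closed) auto
        obtain J where J: "1 / infdist x C < real J" using reals_Archimedean2 by blast
        have "\<forall>\<^sub>F j in sequentially. indicator K x *\<^sub>R max 0 (1 - real j * infdist x C) = 0"
        proof (rule eventually_sequentiallyI[of J])
          fix j assume "J \<le> j"
          then have "1 / infdist x C < real j" using J by linarith
          then have "1 \<le> real j * infdist x C" using d by (simp add: field_simps)
          then show "indicator K x *\<^sub>R max 0 (1 - real j * infdist x C) = 0" by simp
        qed
        then show ?thesis using False by (simp add: tendsto_eventually)
      qed
    qed
    show "AE x in m. norm (indicator K x *\<^sub>R max 0 (1 - real j * infdist x C)) \<le> 1" for j
      by (rule AE_I2) (auto simp: indicator_def infdist_nonneg)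
    show "indicat_real C \<in> borel_measurable m" using Cb by simp
  qed simp
  then show ?thesis using Cb by (simp add: set_lebesgue_integral_def)
qed

lemma compact_approx_measure:
  fixes m :: "'a::{second_countable_topology, complete_space} measure"
  assumes "finite_measure m" and m: "sets m = sets borel" and E: "E \<in> sets borel" and e: "0 < e"
  obtains C where "compact C" "C \<subseteq> E" "measure m E < measure m C + e"
proof -
  interpret finite_measure m by fact
  have "\<exists>C\<in>{C. C \<subseteq> E \<and> compact C}. measure m E < measure m C + e"
  proof (rule ccontr)
    assume "\<not> ?thesis"
    then have *: "\<And>C. C \<subseteq> E \<Longrightarrow> compact C \<Longrightarrow> measure m C \<le> measure m E - e" by force
    have "emeasure m E = (SUP C\<in>{C. C \<subseteq> E \<and> compact C}. emeasure m C)"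
      by (intro inner_regular m E) (simp add: emeasure_eq_measure)
    also have "\<dots> \<le> ennreal (measure m E - e)"
      using * by (intro SUP_least) (auto simp: emeasure_eq_measure intro!: ennreal_leI)
    \<comment> \<open>The instance of \<open>*\<close> at the empty set gives 0 \<le> measure m E -
      e; for a negative number \<open>ennreal\<close> would truncate to 0.\<close>
    finally have "measure m E \<le> measure m E - e"
      using *[of "{}"] by (simp add: emeasure_eq_measure)
    then show False using e by simp
  qed
  then show thesis using that by blast
qed

text \<open>The instance b = 0 of \<open>bound\<close> says that \<Lambda> ignores values off K, and
  scaling by -1 makes the one-sided bound two-sided.\<close>

locale bounded_vector_functional =
  fixes K :: "(real^'n) set" and \<Lambda> :: "(real^'n \<Rightarrow> real^'n) \<Rightarrow> real" and M :: real
  assumes compact_K: "compact K"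
    and add: "\<And>g h. continuous_on K g \<Longrightarrow> continuous_on K h \<Longrightarrow> \<Lambda> (\<lambda>x. g x + h x) = \<Lambda> g + \<Lambda> h"
    and scale: "\<And>c g. continuous_on K g \<Longrightarrow> \<Lambda> (\<lambda>x. c *\<^sub>R g x) = c * \<Lambda> g"
    and bound: "\<And>b g. continuous_on K g \<Longrightarrow> 0 \<le> b \<Longrightarrow> (\<And>x. x \<in> K \<Longrightarrow> norm (g x) \<le> b) \<Longrightarrow> \<Lambda> g \<le> M * b"
begin

lemma zero: "\<Lambda> (\<lambda>_. 0) = 0"
  using scale[of "\<lambda>_. 0" 0] by simp

lemma sum:
  assumes "finite J" "\<And>j. j \<in> J \<Longrightarrow> continuous_on K (f j)"
  shows "\<Lambda> (\<lambda>x. \<Sum>j\<in>J. f j x) = (\<Sum>j\<in>J. \<Lambda> (f j))"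
  using assms
proof (induction J rule: finite_induct)
  case empty
  then show ?case by (simp add: zero)
next
  case (insert j J)
  have "continuous_on K (\<lambda>x. \<Sum>j\<in>J. f j x)"
    using insert.prems by (auto intro!: continuous_intros)
  then show ?case using insert by (simp add: add)
qed

section \<open>The variation of a vector functional\<close>

definition dominated :: "(real^'n \<Rightarrow> real) \<Rightarrow> (real^'n \<Rightarrow> real^'n) set" where
  "dominated h = {g. continuous_on K g \<and> (\<forall>x\<in>K. norm (g x) \<le> h x)}"

text \<open>If \<Lambda> is integration against a vector measure q, this is the integral of h
  against the total variation measure of q.\<close>

definition variation :: "(real^'n \<Rightarrow> real) \<Rightarrow> real" where
  "variation h = (SUP g\<in>dominated h. \<Lambda> g)"

lemma zero_dominated: "cont_nonneg_on K h \<Longrightarrow> (\<lambda>_. 0) \<in> dominated h"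
  by (auto simp: dominated_def cont_nonneg_on_def)

lemma bdd_above_dominated:
  assumes "cont_nonneg_on K h"
  shows "bdd_above (\<Lambda> ` dominated h)"
proof -
  have hc: "continuous_on K h" using assms by (simp add: cont_nonneg_on_def)
  obtain B where B: "\<And>x. x \<in> K \<Longrightarrow> norm (h x) \<le> B"
    using compact_imp_bounded[OF compact_continuous_image[OF hc compact_K]] unfolding bounded_iff by auto
  have "\<Lambda> g \<le> M * max 0 B" if "g \<in> dominated h" for g
    using that B by (intro bound) (fastforce simp: dominated_def)+
  then show ?thesis by (intro bdd_aboveI2)
qed

lemma variation_upper:
  assumes "cont_nonneg_on K h" "continuous_on K g" "\<And>x. x \<in> K \<Longrightarrow> norm (g x) \<le> h x"
  shows "\<Lambda> g \<le> variation h"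
  unfolding variation_def using assms by (intro cSUP_upper bdd_above_dominated) (auto simp: dominated_def)

lemma variation_least:
  assumes "cont_nonneg_on K h"
    and "\<And>g. continuous_on K g \<Longrightarrow> (\<And>x. x \<in> K \<Longrightarrow> norm (g x) \<le> h x) \<Longrightarrow> \<Lambda> g \<le> b"
  shows "variation h \<le> b"
proof -
  have "dominated h \<noteq> {}" using zero_dominated[OF assms(1)] by blast
  then show ?thesis
    unfolding variation_def using assms(2) by (intro cSUP_least) (auto simp: dominated_def)
qed

lemma variation_scale_ge:
  assumes h: "cont_nonneg_on K h" and c: "0 < c"
  shows "c * variation h \<le> variation (\<lambda>x. c * h x)"
proof -
  have ch: "cont_nonneg_on K (\<lambda>x. c * h x)"
    using h c by (auto simp: cont_nonneg_on_def intro!: continuous_intros)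
  have "variation h \<le> variation (\<lambda>x. c * h x) / c"
  proof (rule variation_least[OF h])
    fix g :: "real^'n \<Rightarrow> real^'n"
    assume g: "continuous_on K g" "\<And>x. x \<in> K \<Longrightarrow> norm (g x) \<le> h x"
    have "\<Lambda> (\<lambda>x. c *\<^sub>R g x) \<le> variation (\<lambda>x. c * h x)"
      using g c by (intro variation_upper ch) (auto intro!: continuous_intros)
    then show "\<Lambda> g \<le> variation (\<lambda>x. c * h x) / c"
      using scale[OF g(1), of c] c by (simp add: field_simps)
  qed
  then show ?thesis using c by (simp add: field_simps)
qed

lemma variation_scale:
  assumes h: "cont_nonneg_on K h" and c: "0 \<le> c"
  shows "variation (\<lambda>x. c * h x) = c * variation h"
proof (cases "c = 0")
  case True
  have z: "cont_nonneg_on K (\<lambda>_. 0)" by (simp add: cont_nonneg_on_def)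
  have "variation (\<lambda>_. 0) \<le> M * 0"
    by (intro variation_least z bound) auto
  moreover have "0 \<le> variation (\<lambda>_. 0)"
    using variation_upper[OF z, of "\<lambda>_. 0"] zero by simp
  ultimately show ?thesis using True by simp
next
  case False
  then have c: "0 < c" using c by simp
  have ch: "cont_nonneg_on K (\<lambda>x. c * h x)"
    using h c by (auto simp: cont_nonneg_on_def intro!: continuous_intros)
  have "(1/c) * variation (\<lambda>x. c * h x) \<le> variation (\<lambda>x. (1/c) * (c * h x))"
    using c by (intro variation_scale_ge ch) auto
  also have "(\<lambda>x. (1/c) * (c * h x)) = h" using c by auto
  finally have "variation (\<lambda>x. c * h x) \<le> c * variation h" using c by (simp add: field_simps)
  then show ?thesis using variation_scale_ge[OF h c] by simp
qed

text \<open>For the nontrivial inequality, a field g dominated by h1 + h2 is split in proportion to h1 and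
  h2; the regularisation by e keeps the weights continuous where h1 + h2 vanishes.\<close>
lemma variation_add:
  assumes h1: "cont_nonneg_on K h1" and h2: "cont_nonneg_on K h2"
  shows "variation (\<lambda>x. h1 x + h2 x) = variation h1 + variation h2"
proof (rule antisym)
  have h12: "cont_nonneg_on K (\<lambda>x. h1 x + h2 x)"
    using h1 h2 by (auto simp: cont_nonneg_on_def intro!: continuous_intros)
  have "variation h1 \<le> variation (\<lambda>x. h1 x + h2 x) - variation h2"
  proof (rule variation_least[OF h1])
    fix g1 :: "real^'n \<Rightarrow> real^'n" assume g1: "continuous_on K g1" "\<And>x. x \<in> K \<Longrightarrow> norm (g1 x) \<le> h1 x"
    have "variation h2 \<le> variation (\<lambda>x. h1 x + h2 x) - \<Lambda> g1"
    proof (rule variation_least[OF h2])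
      fix g2 :: "real^'n \<Rightarrow> real^'n" assume g2: "continuous_on K g2" "\<And>x. x \<in> K \<Longrightarrow> norm (g2 x) \<le> h2 x"
      have "\<Lambda> (\<lambda>x. g1 x + g2 x) \<le> variation (\<lambda>x. h1 x + h2 x)"
        using g1 g2 by (intro variation_upper h12 continuous_intros) (auto intro: norm_triangle_mono)
      then show "\<Lambda> g2 \<le> variation (\<lambda>x. h1 x + h2 x) - \<Lambda> g1"
        using add[OF g1(1) g2(1)] by simp
    qed
    then show "\<Lambda> g1 \<le> variation (\<lambda>x. h1 x + h2 x) - variation h2" by simp
  qed
  then show "variation h1 + variation h2 \<le> variation (\<lambda>x. h1 x + h2 x)" by simp
  show "variation (\<lambda>x. h1 x + h2 x) \<le> variation h1 + variation h2"
  proof (rule variation_least[OF h12])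
    fix g :: "real^'n \<Rightarrow> real^'n"
    assume g: "continuous_on K g" "\<And>x. x \<in> K \<Longrightarrow> norm (g x) \<le> h1 x + h2 x"
    have approx: "\<Lambda> g \<le> variation h1 + variation h2 + M * e" if e: "0 < e" for e
    proof -
      define s where "s x = h1 x + h2 x + e" for x
      have c: "continuous_on K h1" "continuous_on K h2" "continuous_on K s"
        using h1 h2 unfolding s_def by (auto simp: cont_nonneg_on_def intro!: continuous_intros)
      have nn: "0 \<le> h1 x" "0 \<le> h2 x" "0 < s x" if "x \<in> K" for x
        using h1 h2 e that by (auto simp: cont_nonneg_on_def s_def intro!: add_nonneg_pos)
      have s0: "s x \<noteq> 0" if "x \<in> K" for x using nn(3)[OF that] by simp
      have part: "continuous_on K (\<lambda>x. (k x / s x) *\<^sub>R g x)" if "continuous_on K k" for k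
        using that c s0 g(1) by (intro continuous_intros) auto
      have part_le: "norm ((k x / s x) *\<^sub>R g x) \<le> k x" if "x \<in> K" "0 \<le> k x" for k x
      proof -
        have "norm ((k x / s x) *\<^sub>R g x) = k x * (norm (g x) / s x)"
          using that nn(3)[OF that(1)] by simp
        also have "\<dots> \<le> k x * 1"
          using that nn(3)[OF that(1)] g(2)[OF that(1)] e
          by (intro mult_left_mono) (auto simp: s_def divide_le_eq)
        finally show ?thesis by simp
      qed
      define r where "r = (\<lambda>x. (h1 x / s x) *\<^sub>R g x + (h2 x / s x) *\<^sub>R g x + (e / s x) *\<^sub>R g x)"
      have r: "r x = g x" if "x \<in> K" for x
      proof -
        have "r x = ((h1 x + h2 x + e) / s x) *\<^sub>R g x"
          by (simp add: r_def scaleR_add_left[symmetric] add_divide_distrib)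
        then show ?thesis using s0[OF that] by (simp add: s_def)
      qed
      have rc: "continuous_on K r"
        unfolding r_def using part c by (intro continuous_on_add) auto
      \<comment> \<open>r agrees with g only on K, as s may vanish elsewhere; \<open>bound\<close>
        with b = 0 transfers \<Lambda> from one to the other.\<close>
      have "\<Lambda> (\<lambda>x. g x + (-1) *\<^sub>R r x) \<le> M * 0"
        using r g rc by (intro bound continuous_intros) auto
      then have "\<Lambda> g \<le> \<Lambda> r"
        using add[OF g(1) continuous_on_scaleR[OF continuous_on_const rc], of "-1"] scale[OF rc, of "-1"] by simp
      also have "\<Lambda> r = \<Lambda> (\<lambda>x. (h1 x / s x) *\<^sub>R g x) + \<Lambda> (\<lambda>x. (h2 x / s x) *\<^sub>R g x) + \<Lambda> (\<lambda>x. (e / s x) *\<^sub>R g x)"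
        unfolding r_def using part[OF c(1)] part[OF c(2)] part[of "\<lambda>_. e"]
        by (subst add; (intro continuous_on_add)?; simp add: add)
      also have "\<dots> \<le> variation h1 + variation h2 + M * e"
        using e nn part_le[where k = "\<lambda>_. e"]
        by (intro add_mono variation_upper h1 h2 part c part_le bound) auto
      finally show ?thesis .
    qed
    have "(\<lambda>n. variation h1 + variation h2 + M * (1 / real n)) \<longlonglongrightarrow> variation h1 + variation h2 + M * 0"
      by (intro tendsto_intros lim_1_over_n)
    moreover have "\<exists>N. \<forall>n\<ge>N. \<Lambda> g \<le> variation h1 + variation h2 + M * (1 / real n)"
      by (intro exI[of _ 1] allI impI approx) simp
    ultimately show "\<Lambda> g \<le> variation h1 + variation h2"
      using LIMSEQ_le_const by fastforce
  qed
qed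

lemma variation_nonneg: "cont_nonneg_on K h \<Longrightarrow> 0 \<le> variation h"
  using variation_upper[of h "\<lambda>_. 0"] zero by (simp add: cont_nonneg_on_def)

sublocale var: positive_functional K variation
  using compact_K variation_add variation_scale variation_nonneg by unfold_locales

section \<open>Components of the functional and their measures\<close>

definition component :: "'n \<Rightarrow> (real^'n \<Rightarrow> real) \<Rightarrow> real" where
  "component i h = \<Lambda> (\<lambda>x. h x *\<^sub>R axis i 1)"

lemma component_add:
  "continuous_on K h \<Longrightarrow> continuous_on K k \<Longrightarrow> component i (\<lambda>x. h x + k x) = component i h + component i k"
  unfolding component_def scaleR_add_left by (intro add continuous_intros)

lemma component_scale: "continuous_on K h \<Longrightarrow> component i (\<lambda>x. c * h x) = c * component i h"
  unfolding component_def scaleR_scaleR[symmetric] by (intro scale continuous_intros)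

text \<open>The field -h times the i-th unit vector is dominated by h, so minus the component is at
  most the variation.\<close>

lemma shifted_component: "positive_functional K (\<lambda>h. component i h + variation h)"
proof
  fix h assume h: "cont_nonneg_on K h"
  then have hc: "continuous_on K h" by (simp add: cont_nonneg_on_def)
  have "\<Lambda> (\<lambda>x. (-1) *\<^sub>R (h x *\<^sub>R axis i 1)) \<le> variation h"
    using h by (intro variation_upper continuous_intros hc) (auto simp: cont_nonneg_on_def)
  moreover have "\<Lambda> (\<lambda>x. (-1) *\<^sub>R (h x *\<^sub>R axis i 1)) = (-1) * component i h"
    unfolding component_def by (intro scale continuous_intros hc)
  ultimately show "0 \<le> component i h + variation h" by simp
qed (auto simp: compact_K component_add component_scale variation_add variation_scale algebra_simps
      cont_nonneg_on_def)

text \<open>Each component is the difference of the positive functionals \<open>component i + variation\<close> and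
  \<open>variation\<close>; this replaces the Jordan decomposition, at the price of a larger negative part.\<close>
definition pos_part :: "'n \<Rightarrow> (real^'n) measure" where
  "pos_part i = positive_functional.riesz_measure K (\<lambda>h. component i h + variation h)"

definition neg_part :: "'n \<Rightarrow> (real^'n) measure" where
  "neg_part i = var.riesz_measure"

lemma vmeasure_on_parts: "vmeasure_on K pos_part neg_part"
  unfolding vmeasure_on_def pos_part_def neg_part_def
  using positive_functional.sets_riesz_measure[OF shifted_component]
    positive_functional.finite_measure_riesz_measure[OF shifted_component]
    positive_functional.emeasure_riesz_measure_Compl[OF shifted_component]
    var.finite_measure_riesz_measure var.emeasure_riesz_measure_Compl
  by auto

lemma sets_pos_part [simp]: "sets (pos_part i) = sets borel"
  and finite_measure_pos_part: "finite_measure (pos_part i)"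
  using vmeasure_on_parts by (auto simp: vmeasure_on_def)

lemma component_eq_integral_nonneg:
  assumes "cont_nonneg_on K h"
  shows "component i h = (LINT x:K|pos_part i. h x) - (LINT x:K|neg_part i. h x)"
  using positive_functional.Riesz_representation[OF shifted_component assms, of i] var.Riesz_representation[OF assms]
  by (simp add: pos_part_def neg_part_def)

lemma component_eq_integral:
  assumes h: "continuous_on K h"
  shows "component i h = (LINT x:K|pos_part i. h x) - (LINT x:K|neg_part i. h x)"
proof -
  define hp where "hp x = max 0 (h x)" for x
  define hn where "hn x = max 0 (- h x)" for x
  have c: "cont_nonneg_on K hp" "cont_nonneg_on K hn"
    using h by (auto simp: cont_nonneg_on_def hp_def hn_def intro!: continuous_intros)
  have cc: "continuous_on K hp" "continuous_on K hn" "continuous_on K (\<lambda>x. (-1) * hn x)"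
    using c by (auto simp: cont_nonneg_on_def intro!: continuous_intros)
  have heq: "h = (\<lambda>x. hp x + (-1) * hn x)" by (auto simp: hp_def hn_def fun_eq_iff)
  have int: "(LINT x:K|m. h x) = (LINT x:K|m. hp x) - (LINT x:K|m. hn x)"
    if "finite_measure m" "sets m = sets borel" for m
    unfolding heq
    using set_integral_diff(2)[OF set_integrable_continuous_on_compact[OF that compact_K cc(1)]
        set_integrable_continuous_on_compact[OF that compact_K cc(2)]] by simp
  have "component i h = component i hp + (-1) * component i hn"
    unfolding heq using component_add[OF cc(1,3)] component_scale[OF cc(2), of _ "-1"] by simp
  then show ?thesis
    using component_eq_integral_nonneg[OF c(1)] component_eq_integral_nonneg[OF c(2)]
      int[of "pos_part i"] int[of "neg_part i"] vmeasure_on_parts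
    by (simp add: vmeasure_on_def)
qed

lemma vintegral_parts:
  assumes g: "continuous_on K g"
  shows "vintegral K pos_part neg_part g = \<Lambda> g"
proof -
  have gi: "continuous_on K (\<lambda>x. g x $ i)" for i using g by (intro continuous_intros)
  have "g x = (\<Sum>i\<in>UNIV. (g x $ i) *\<^sub>R axis i 1)" for x
    by (metis basis_expansion scalar_mult_eq_scaleR)
  then have "g = (\<lambda>x. \<Sum>i\<in>UNIV. (g x $ i) *\<^sub>R axis i 1)" by blast
  then have "\<Lambda> g = (\<Sum>i\<in>UNIV. component i (\<lambda>x. g x $ i))"
    using sum[of UNIV "\<lambda>i x. (g x $ i) *\<^sub>R axis i 1"] gi
    by (simp add: component_def continuous_on_scaleR)
  then show ?thesis unfolding vintegral_def using component_eq_integral[OF gi] by simp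
qed

section \<open>The total variation of the representing measure\<close>

lemma norm_component_le_variation:
  assumes h: "cont_nonneg_on K h"
  shows "norm (\<chi> i. component i h) \<le> variation h"
proof -
  define v where "v = (\<chi> i. component i h)"
  have hc: "continuous_on K h" using h by (simp add: cont_nonneg_on_def)
  \<comment> \<open>Testing \<Lambda> with the single field h v, of norm \<open>norm v * h\<close>,
    treats all components at once and so keeps the Euclidean norm without a dimensional
    factor.\<close>
  have "norm v * norm v = (\<Sum>i\<in>UNIV. v $ i * component i h)"
    by (simp add: power2_eq_square[symmetric] power2_norm_eq_inner inner_vec_def v_def)
  also have "\<dots> = (\<Sum>i\<in>UNIV. \<Lambda> (\<lambda>x. (v $ i) *\<^sub>R (h x *\<^sub>R axis i 1)))"
    unfolding component_def by (intro sum.cong refl scale[symmetric] continuous_intros hc)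
  also have "\<dots> = \<Lambda> (\<lambda>x. \<Sum>i\<in>UNIV. (v $ i) *\<^sub>R (h x *\<^sub>R axis i 1))"
    by (intro sum[symmetric] continuous_intros hc) auto
  also have "(\<lambda>x. \<Sum>i\<in>UNIV. (v $ i) *\<^sub>R (h x *\<^sub>R axis i 1)) = (\<lambda>x. h x *\<^sub>R v)"
  proof
    fix x
    have "v = (\<Sum>i\<in>UNIV. (v $ i) *\<^sub>R axis i 1)" by (metis basis_expansion scalar_mult_eq_scaleR)
    then have "h x *\<^sub>R v = h x *\<^sub>R (\<Sum>i\<in>UNIV. (v $ i) *\<^sub>R axis i 1)" by simp
    then show "(\<Sum>i\<in>UNIV. (v $ i) *\<^sub>R (h x *\<^sub>R axis i 1)) = h x *\<^sub>R v"
      by (simp add: scaleR_sum_right mult.commute)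
  qed
  also have "\<Lambda> (\<lambda>x. h x *\<^sub>R v) \<le> variation (\<lambda>x. norm v * h x)"
    using h by (intro variation_upper continuous_intros hc) (auto simp: cont_nonneg_on_def intro!: continuous_intros)
  also have "\<dots> = norm v * variation h" by (intro variation_scale h) auto
  finally have "norm v * norm v \<le> norm v * variation h" .
  then have "norm v \<le> variation h"
    using variation_nonneg[OF h] by (cases "norm v = 0") (auto simp: mult_le_cancel_left)
  then show ?thesis by (simp add: v_def)
qed

text \<open>The bound of component values by the variation holds along the cutoffs of C; both sides
  converge to the measures of C.\<close>

lemma norm_vmeasure_val_compact:
  assumes C: "compact C" "C \<subseteq> K"
  shows "norm (vmeasure_val pos_part neg_part C) \<le> measure var.riesz_measure C"
proof (cases "C = {}")
  case True
  then show ?thesis by (simp add: vmeasure_val_def zero_vec_def[symmetric])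
next
  case False
  define h where "h j x = max 0 (1 - real j * infdist x C)" for j x
  have h: "cont_nonneg_on K (h j)" for j
    unfolding h_def by (auto simp: cont_nonneg_on_def intro!: continuous_intros)
  have lim: "(\<lambda>j. LINT x:K|m. h j x) \<longlonglongrightarrow> measure m C" if "finite_measure m" "sets m = sets borel" for m
    unfolding h_def by (rule LIMSEQ_cutoff_integral[OF that compact_K C False])
  have "(\<lambda>j. \<chi> i. component i (h j)) \<longlonglongrightarrow> vmeasure_val pos_part neg_part C"
    unfolding vmeasure_val_def component_eq_integral_nonneg[OF h]
    using vmeasure_on_parts by (intro tendsto_vec_lambda tendsto_diff lim) (auto simp: vmeasure_on_def)
  then have "(\<lambda>j. norm (\<chi> i. component i (h j))) \<longlonglongrightarrow> norm (vmeasure_val pos_part neg_part C)"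
    by (rule tendsto_norm)
  moreover have "(\<lambda>j. variation (h j)) \<longlonglongrightarrow> measure var.riesz_measure C"
    unfolding var.Riesz_representation[OF h] by (intro lim var.finite_measure_riesz_measure) simp
  ultimately show ?thesis
    using norm_component_le_variation[OF h] by (intro LIMSEQ_le[where X = "\<lambda>j. norm (\<chi> i. component i (h j))"]) auto
qed

text \<open>Inner regularity of finitely many measures: the union of one compact set per positive
  part and one for the variation measure approximates E for all of them. The latter is the negative
  part of every component.\<close>

lemma norm_vmeasure_val_le:
  assumes E: "E \<in> sets borel" "E \<subseteq> K"
  shows "norm (vmeasure_val pos_part neg_part E) \<le> measure var.riesz_measure E"
proof (rule field_le_epsilon)
  fix e :: real assume "0 < e"
  interpret mu: finite_measure var.riesz_measure by (rule var.finite_measure_riesz_measure)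
  \<comment> \<open>The Euclidean norm is bounded by the sum of the components, so each may
    contribute e divided by the dimension.\<close>
  define d where "d = e / real CARD('n)"
  have d: "0 < d" using \<open>0 < e\<close> by (simp add: d_def)
  have "\<exists>C. compact C \<and> C \<subseteq> E \<and> measure (pos_part i) E < measure (pos_part i) C + d" for i
    using compact_approx_measure[OF finite_measure_pos_part sets_pos_part E(1) d] by metis
  then obtain D where D: "\<And>i. compact (D i)" "\<And>i. D i \<subseteq> E"
    "\<And>i. measure (pos_part i) E < measure (pos_part i) (D i) + d" by metis
  obtain D0 where D0: "compact D0" "D0 \<subseteq> E" "measure var.riesz_measure E < measure var.riesz_measure D0 + d"
    using compact_approx_measure[OF var.finite_measure_riesz_measure var.sets_riesz_measure E(1) d] by metis
  define C where "C = D0 \<union> (\<Union>i. D i)"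
  have C: "compact C" "C \<subseteq> E"
    unfolding C_def using D D0 by (auto intro!: compact_Un compact_UN)
  have Cb: "C \<in> sets borel" using compact_imp_closed[OF C(1)] by simp
  \<comment> \<open>In passing from E to C both measures lose an amount between 0 and d, so the
    difference of the losses is at most d in absolute value.\<close>
  have "\<bar>(vmeasure_val pos_part neg_part E - vmeasure_val pos_part neg_part C) $ i\<bar> \<le> d" for i
  proof -
    interpret q: finite_measure "pos_part i" by (rule finite_measure_pos_part)
    have "measure (pos_part i) (D i) \<le> measure (pos_part i) C" "measure (pos_part i) C \<le> measure (pos_part i) E"
      using Cb E C by (auto intro!: q.finite_measure_mono simp: C_def)
    moreover have "measure var.riesz_measure D0 \<le> measure var.riesz_measure C"
      "measure var.riesz_measure C \<le> measure var.riesz_measure E"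
      using Cb E C by (auto intro!: mu.finite_measure_mono simp: C_def)
    ultimately show ?thesis
      using D(3)[of i] D0(3) by (simp add: vmeasure_val_def neg_part_def abs_le_iff)
  qed
  then have "(\<Sum>i\<in>UNIV. \<bar>(vmeasure_val pos_part neg_part E - vmeasure_val pos_part neg_part C) $ i\<bar>)
      \<le> (\<Sum>i::'n\<in>UNIV. d)"
    by (rule sum_mono)
  then have "norm (vmeasure_val pos_part neg_part E - vmeasure_val pos_part neg_part C) \<le> e"
    using norm_le_l1_cart[of "vmeasure_val pos_part neg_part E - vmeasure_val pos_part neg_part C"]
    by (simp add: d_def)
  moreover have "norm (vmeasure_val pos_part neg_part C) \<le> measure var.riesz_measure C"
    using C E by (intro norm_vmeasure_val_compact) auto
  moreover have "measure var.riesz_measure C \<le> measure var.riesz_measure E"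
    using C E by (intro mu.finite_measure_mono) auto
  ultimately show "norm (vmeasure_val pos_part neg_part E) \<le> measure var.riesz_measure E + e"
    using norm_triangle_sub[of "vmeasure_val pos_part neg_part E" "vmeasure_val pos_part neg_part C"] by linarith
qed

text \<open>Cell by cell the vector measure is below one additive measure, whose mass is the
  variation of the constant 1, a supremum of \<Lambda> over fields of norm at most 1.\<close>

lemma total_variation_parts: "total_variation pos_part neg_part K \<le> ereal M"
  unfolding total_variation_def
proof (rule SUP_least)
  interpret mu: finite_measure var.riesz_measure by (rule var.finite_measure_riesz_measure)
  fix P assume "P \<in> {P. finite P \<and> P \<subseteq> sets borel \<and> disjoint P \<and> \<Union>P = K}"
  then have P: "finite P" "P \<subseteq> sets borel" "disjoint P" "\<Union>P = K" by auto
  have "(\<Sum>E\<in>P. norm (vmeasure_val pos_part neg_part E)) \<le> (\<Sum>E\<in>P. measure var.riesz_measure E)"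
    using P by (intro sum_mono norm_vmeasure_val_le) auto
  also have "\<dots> = measure var.riesz_measure (\<Union>E\<in>P. E)"
    using P by (intro mu.finite_measure_finite_Union[symmetric])
      (auto simp: disjoint_family_on_def disjoint_def)
  also have "\<dots> \<le> measure var.riesz_measure UNIV" by (intro mu.finite_measure_mono) auto
  also have "\<dots> = variation (\<lambda>_. 1)" by (simp add: var.measure_riesz_measure_UNIV var.mass_def)
  also have "\<dots> \<le> M * 1"
    by (intro variation_least bound) (auto simp: cont_nonneg_on_def)
  finally show "ereal (\<Sum>E\<in>P. norm (vmeasure_val pos_part neg_part E)) \<le> ereal M" by simp
qed

end

section \<open>Duality\<close>

text \<open>The fibres of \<open>floor (N * g)\<close> form a finite Borel partition on whose cells g oscillates by at
  most 1/N in each component.\<close>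
lemma vintegral_le_total_variation:
  fixes K :: "(real^'n) set"
  assumes K: "compact K" and q: "vmeasure_on K qp qm"
    and g: "continuous_on K g" and g1: "\<And>x. x \<in> K \<Longrightarrow> norm (g x) \<le> 1"
  shows "ereal (vintegral K qp qm g) \<le> total_variation qp qm K"
proof -
  have qp: "finite_measure (qp i)" "sets (qp i) = sets borel"
    and qm: "finite_measure (qm i)" "sets (qm i) = sets borel" for i
    using q by (auto simp: vmeasure_on_def)
  have Kb: "K \<in> sets borel" using compact_imp_closed[OF K] by simp
  \<comment> \<open>An error of 1/N in every component, integrated over K against all the measures,
    is \<open>T / N\<close>.\<close>
  define T where "T = (\<Sum>i\<in>UNIV. measure (qp i) K + measure (qm i) K)"
  have approx: "ereal (vintegral K qp qm g - T / real N) \<le> total_variation qp qm K" if N: "0 < N" for N :: nat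
  proof -
    define F where "F x i = \<lfloor>g x $ i * real N\<rfloor>" for x i
    define Z where "Z = F ` K"
    \<comment> \<open>Components of g lie in [-1, 1] on K, so only floors between -N and N occur and
      the partition is finite.\<close>
    have "Z \<subseteq> PiE UNIV (\<lambda>_. {- int N .. int N})"
    proof
      fix z assume "z \<in> Z"
      then obtain x where x: "x \<in> K" "z = F x" by (auto simp: Z_def)
      have "z i \<in> {- int N .. int N}" for i
      proof -
        have "\<bar>g x $ i\<bar> \<le> 1"
          using component_le_norm_cart[of "g x" i] g1[OF x(1)] by linarith
        then have "\<bar>g x $ i\<bar> * real N \<le> 1 * real N" by (intro mult_right_mono) auto
        then have "\<bar>g x $ i * real N\<bar> \<le> real N" by (simp add: abs_mult)
        then have "- real N \<le> g x $ i * real N" "g x $ i * real N \<le> real N" by linarith+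
        then show ?thesis unfolding x F_def by (simp add: le_floor_iff floor_le_iff)
      qed
      then show "z \<in> PiE UNIV (\<lambda>_. {- int N .. int N})" by auto
    qed
    moreover have "finite (PiE (UNIV :: 'n set) (\<lambda>_. {- int N .. int N}))" by (intro finite_PiE) auto
    ultimately have Z: "finite Z" by (rule finite_subset)
    define A where "A z = {x\<in>K. F x = z}" for z
    have A: "A z \<in> sets borel" for z
    proof -
      \<comment> \<open>g is continuous on K only; its extension by 0 is Borel on the whole
        space.\<close>
      define G where "G x = indicator K x *\<^sub>R g x" for x
      have G: "(\<lambda>x. G x $ i) \<in> borel_measurable borel" for i
      proof -
        have "(\<lambda>x. indicator K x *\<^sub>R (g x $ i)) \<in> borel_measurable borel"
          by (intro borel_measurable_continuous_on_indicator Kb continuous_intros g)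
        then show ?thesis by (simp add: G_def)
      qed
      have "{x. real_of_int (z i) \<le> G x $ i * real N} \<in> sets borel" "{x. G x $ i * real N < real_of_int (z i) + 1} \<in> sets borel" for i
        using G[of i] by measurable
      then have "K \<inter> (\<Inter>i. {x. real_of_int (z i) \<le> G x $ i * real N} \<inter> {x. G x $ i * real N < real_of_int (z i) + 1}) \<in> sets borel"
        using Kb by (intro sets.Int sets.countable_INT') auto
      also have "K \<inter> (\<Inter>i. {x. real_of_int (z i) \<le> G x $ i * real N} \<inter> {x. G x $ i * real N < real_of_int (z i) + 1}) = A z"
        by (auto simp: A_def F_def G_def fun_eq_iff floor_eq_iff)
      finally show ?thesis .
    qed
    \<comment> \<open>Each cell gets a value of g at one of its points. The obvious value z / N
      could have norm above 1, since the floor enlarges negative entries in absolute value.\<close>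
    define y where "y z = (SOME x. x \<in> A z)" for z
    have y: "y z \<in> K" "F (y z) = z" if z: "z \<in> Z" for z
    proof -
      obtain x where "x \<in> A z" using z by (auto simp: A_def Z_def)
      then have "y z \<in> A z" unfolding y_def by (rule someI)
      then show "y z \<in> K" "F (y z) = z" by (simp_all add: A_def)
    qed
    define w where "w z = g (y z)" for z
    have w1: "norm (w z) \<le> 1" if "z \<in> Z" for z
      unfolding w_def by (rule g1[OF y(1)[OF that]])
    have gw: "\<bar>g x $ i - w (F x) $ i\<bar> \<le> 1 / real N" if "x \<in> K" for x i
    proof -
      have "F x \<in> Z" using that by (simp add: Z_def)
      then have "F (y (F x)) i = F x i" by (simp only: y(2))
      then have "\<lfloor>w (F x) $ i * real N\<rfloor> = \<lfloor>g x $ i * real N\<rfloor>" by (simp add: F_def w_def)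
      then have "\<bar>g x $ i * real N - w (F x) $ i * real N\<bar> \<le> 1" by linarith
      then have "\<bar>g x $ i - w (F x) $ i\<bar> * real N \<le> 1"
        by (simp add: left_diff_distrib[symmetric] abs_mult)
      then show ?thesis using N by (simp add: field_simps)
    qed
    have int: "\<bar>(LINT x:K|m. g x $ i) - (\<Sum>z\<in>Z. w z $ i * measure m (A z))\<bar> \<le> measure m K / real N"
      if m: "finite_measure m" "sets m = sets borel" for m i
    proof -
      interpret finite_measure m by fact
      have gi: "integrable m (\<lambda>x. indicator K x * g x $ i)"
        using set_integrable_continuous_on_compact[OF m K, of "\<lambda>x. g x $ i"] g
        by (simp add: set_integrable_def continuous_on_component)
      have Ai: "integrable m (\<lambda>x. w z $ i * indicat_real (A z) x)" for z
        using A[of z] m by (intro integrable_mult_right integrable_real_indicator) (auto simp: emeasure_eq_measure)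
      have Ki: "integrable m (indicat_real K)"
        using Kb m by (intro integrable_real_indicator) (auto simp: emeasure_eq_measure)
      have "(\<Sum>z\<in>Z. w z $ i * measure m (A z)) = integral\<^sup>L m (\<lambda>x. \<Sum>z\<in>Z. w z $ i * indicat_real (A z) x)"
        using Ai A m by (subst Bochner_Integration.integral_sum) auto
      then have "(LINT x:K|m. g x $ i) - (\<Sum>z\<in>Z. w z $ i * measure m (A z))
          = integral\<^sup>L m (\<lambda>x. indicator K x * g x $ i - (\<Sum>z\<in>Z. w z $ i * indicat_real (A z) x))"
        using gi Ai by (simp add: set_lebesgue_integral_def Bochner_Integration.integral_diff)
      also have "\<bar>\<dots>\<bar> \<le> integral\<^sup>L m (\<lambda>x. indicat_real K x * (1 / real N))"
      proof (rule integral_abs_bound_integral)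
        fix x
        have "(\<Sum>z\<in>Z. w z $ i * indicat_real (A z) x) = indicat_real K x * w (F x) $ i"
        proof (cases "x \<in> K")
          case True
          then have "(\<Sum>z\<in>Z. w z $ i * indicat_real (A z) x) = (\<Sum>z\<in>Z. if z = F x then w z $ i else 0)"
            by (intro sum.cong) (auto simp: A_def indicator_def)
          then show ?thesis using True Z by (simp add: Z_def)
        qed (simp add: A_def)
        then show "\<bar>indicat_real K x * g x $ i - (\<Sum>z\<in>Z. w z $ i * indicat_real (A z) x)\<bar>
            \<le> indicat_real K x * (1 / real N)"
          using gw[of x i] by (simp add: indicator_def)
      qed (use gi Ai Ki in auto)
      also have "\<dots> = measure m K / real N" using Kb m by simp
      finally show ?thesis .
    qed
    \<comment> \<open>Partitions in \<open>total_variation\<close> are sets of sets, so the sum over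
      indices must not repeat a cell; cells with index in Z are nonempty and hence distinct.\<close>
    have inj: "inj_on A Z"
    proof (rule inj_onI)
      fix z z' assume z: "z \<in> Z" "z' \<in> Z" "A z = A z'"
      have "y z \<in> A z" using y[OF z(1)] by (simp add: A_def)
      then have "y z \<in> A z'" using z(3) by simp
      then show "z = z'" using y(2)[OF z(1)] by (simp add: A_def)
    qed
    have "vintegral K qp qm g - T / real N \<le> (\<Sum>i\<in>UNIV. (\<Sum>z\<in>Z. w z $ i * measure (qp i) (A z)) - (\<Sum>z\<in>Z. w z $ i * measure (qm i) (A z)))"
    proof -
      have "vintegral K qp qm g - T / real N = (\<Sum>i\<in>UNIV. ((LINT x:K|qp i. g x $ i) - measure (qp i) K / real N)
          - ((LINT x:K|qm i. g x $ i) + measure (qm i) K / real N))"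
        unfolding vintegral_def T_def sum_divide_distrib sum_subtractf[symmetric]
        by (intro sum.cong) (auto simp: add_divide_distrib)
      also have "\<dots> \<le> (\<Sum>i\<in>UNIV. (\<Sum>z\<in>Z. w z $ i * measure (qp i) (A z)) - (\<Sum>z\<in>Z. w z $ i * measure (qm i) (A z)))"
      proof (rule sum_mono)
        fix i
        show "((LINT x:K|qp i. g x $ i) - measure (qp i) K / real N) - ((LINT x:K|qm i. g x $ i) + measure (qm i) K / real N)
          \<le> (\<Sum>z\<in>Z. w z $ i * measure (qp i) (A z)) - (\<Sum>z\<in>Z. w z $ i * measure (qm i) (A z))"
          using int[OF qp, of i i] int[OF qm, of i i] by linarith
      qed
      finally show ?thesis .
    qed
    also have "\<dots> = (\<Sum>z\<in>Z. w z \<bullet> vmeasure_val qp qm (A z))"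
      unfolding inner_vec_def vmeasure_val_def sum_subtractf[symmetric]
      by (subst sum.swap) (simp add: right_diff_distrib)
    also have "\<dots> \<le> (\<Sum>z\<in>Z. norm (vmeasure_val qp qm (A z)))"
    proof (rule sum_mono)
      fix z assume "z \<in> Z"
      have "w z \<bullet> vmeasure_val qp qm (A z) \<le> norm (w z) * norm (vmeasure_val qp qm (A z))"
        by (rule norm_cauchy_schwarz)
      also have "\<dots> \<le> 1 * norm (vmeasure_val qp qm (A z))"
        using w1[OF \<open>z \<in> Z\<close>] by (intro mult_right_mono) auto
      finally show "w z \<bullet> vmeasure_val qp qm (A z) \<le> norm (vmeasure_val qp qm (A z))" by simp
    qed
    also have "\<dots> = (\<Sum>E\<in>A ` Z. norm (vmeasure_val qp qm E))"
      by (simp add: sum.reindex[OF inj])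
    finally have "ereal (vintegral K qp qm g - T / real N) \<le> ereal (\<Sum>E\<in>A ` Z. norm (vmeasure_val qp qm E))"
      by simp
    also have "\<dots> \<le> total_variation qp qm K"
      unfolding total_variation_def
    proof (rule SUP_upper)
      have "\<Union>(A ` Z) = K" by (auto simp: A_def Z_def)
      moreover have "disjoint (A ` Z)" by (auto simp: disjoint_def A_def)
      ultimately show "A ` Z \<in> {P. finite P \<and> P \<subseteq> sets borel \<and> disjoint P \<and> \<Union>P = K}"
        using Z A by auto
    qed
    finally show ?thesis .
  qed
  have "(\<lambda>N. vintegral K qp qm g - T * (1 / real N)) \<longlonglongrightarrow> vintegral K qp qm g - T * 0"
    by (intro tendsto_intros lim_1_over_n)
  then have "(\<lambda>N. ereal (vintegral K qp qm g - T / real N)) \<longlonglongrightarrow> ereal (vintegral K qp qm g)"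
    by simp
  then show ?thesis
    by (rule LIMSEQ_le_const2) (use approx in \<open>auto intro!: exI[of _ 1]\<close>)
qed

section \<open>Test functions and weak duality\<close>

lemma C1_0_zero: "C1_0 \<Omega> (\<lambda>_. 0) (\<lambda>_. 0)"
  by (auto simp: C1_0_def C1_closure_def)

lemma C1_0_add:
  assumes "C1_0 \<Omega> \<phi> g" "C1_0 \<Omega> \<psi> h"
  shows "C1_0 \<Omega> (\<lambda>x. \<phi> x + \<psi> x) (\<lambda>x. g x + h x)"
proof -
  have "((\<lambda>x. \<phi> x + \<psi> x) has_derivative (\<lambda>k. (g x + h x) \<bullet> k)) (at x)" if "x \<in> \<Omega>" for x
    unfolding inner_add_left using assms that
    by (intro has_derivative_add) (auto simp: C1_0_def C1_closure_def)
  then show ?thesis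
    using assms by (auto simp: C1_0_def C1_closure_def intro!: continuous_intros)
qed

lemma C1_0_scale:
  assumes "C1_0 \<Omega> \<phi> g"
  shows "C1_0 \<Omega> (\<lambda>x. c * \<phi> x) (\<lambda>x. c *\<^sub>R g x)"
proof -
  have "((\<lambda>x. c * \<phi> x) has_derivative (\<lambda>k. (c *\<^sub>R g x) \<bullet> k)) (at x)" if "x \<in> \<Omega>" for x
    unfolding inner_scaleR_left using assms that
    by (intro has_derivative_mult_right) (auto simp: C1_0_def C1_closure_def)
  then show ?thesis
    using assms by (auto simp: C1_0_def C1_closure_def intro!: continuous_intros)
qed

text \<open>\<phi> is bounded on the compact closure, and |f| \<le> 1 + f^2 is integrable on a set
  of finite measure. This is what makes the right-hand side of the constraint additive in
  \<phi>.\<close>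

lemma set_integrable_L2_times_C1_0:
  fixes f :: "real^'n \<Rightarrow> real"
  assumes \<Omega>: "open \<Omega>" "bounded \<Omega>" and f: "f \<in> borel_measurable (lebesgue_on \<Omega>)"
    and f2: "integrable (lebesgue_on \<Omega>) (\<lambda>x. (f x)\<^sup>2)" and \<phi>: "C1_0 \<Omega> \<phi> g"
  shows "set_integrable lebesgue \<Omega> (\<lambda>x. f x * \<phi> x)"
proof -
  have lm: "\<Omega> \<in> lmeasurable" using \<Omega> by (simp add: lmeasurable_open)
  have \<Omega>l: "\<Omega> \<in> sets lebesgue" using lm by (simp add: fmeasurableD)
  have c: "continuous_on (closure \<Omega>) \<phi>" using \<phi> by (simp add: C1_0_def C1_closure_def)
  have "compact (closure \<Omega>)" using \<Omega> by simp
  then obtain B where B: "\<And>x. x \<in> closure \<Omega> \<Longrightarrow> norm (\<phi> x) \<le> B"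
    using compact_imp_bounded[OF compact_continuous_image[OF c]] unfolding bounded_iff by auto
  have "\<phi> \<in> borel_measurable (lebesgue_on \<Omega>)"
    using continuous_on_subset[OF c closure_subset] \<Omega>l by (rule continuous_imp_measurable_on_sets_lebesgue)
  then have meas: "(\<lambda>x. f x * \<phi> x) \<in> borel_measurable (lebesgue_on \<Omega>)" using f by simp
  have "integrable (lebesgue_on \<Omega>) (\<lambda>x. B * (1 + (f x)\<^sup>2))"
    using f2 finite_measure.integrable_const[OF finite_measure_lebesgue_on[OF lm], of 1]
    by (intro integrable_mult_right Bochner_Integration.integrable_add) auto
  then have "integrable (lebesgue_on \<Omega>) (\<lambda>x. f x * \<phi> x)"
  proof (rule Bochner_Integration.integrable_bound[OF _ meas])
    show "AE x in lebesgue_on \<Omega>. norm (f x * \<phi> x) \<le> norm (B * (1 + (f x)\<^sup>2))"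
    proof (rule AE_I2)
      fix x assume "x \<in> space (lebesgue_on \<Omega>)"
      then have "x \<in> closure \<Omega>" using closure_subset by auto
      then have b: "\<bar>\<phi> x\<bar> \<le> B" using B by force
      have "\<bar>f x\<bar> \<le> 1 + (f x)\<^sup>2"
        using zero_le_power2[of "\<bar>f x\<bar> - 1"] by (simp add: power2_eq_square algebra_simps abs_if split: if_splits)
      then have "\<bar>f x\<bar> * \<bar>\<phi> x\<bar> \<le> (1 + (f x)\<^sup>2) * B"
        using b by (intro mult_mono) auto
      then show "norm (f x * \<phi> x) \<le> norm (B * (1 + (f x)\<^sup>2))"
        using b by (simp add: abs_mult mult.commute)
    qed
  qed
  then show ?thesis
    unfolding set_integrable_def using \<Omega>l by (subst (asm) integrable_restrict_space) auto
qed

text \<open>The minus sign in the constraint is absorbed by testing with -u, whose gradient has the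
  same norm.\<close>

lemma pd_loc_le_p_loc:
  assumes "bounded \<Omega>"
  shows "pd_loc \<Omega> f \<le> p_loc \<Omega> f"
proof -
  have K: "compact (closure \<Omega>)" using assms by simp
  have "ereal (LINT x:\<Omega>|lebesgue. f x * u x) \<le> total_variation qp qm (closure \<Omega>)"
    if q: "admissible \<Omega> f qp qm" and u: "C1_0 \<Omega> u g" "\<And>x. x \<in> closure \<Omega> \<Longrightarrow> norm (g x) \<le> 1" for qp qm u g
  proof -
    have n: "C1_0 \<Omega> (\<lambda>x. -1 * u x) (\<lambda>x. -1 *\<^sub>R g x)" by (rule C1_0_scale[OF u(1)])
    have "- vintegral (closure \<Omega>) qp qm (\<lambda>x. -1 *\<^sub>R g x) = (LINT x:\<Omega>|lebesgue. f x * (-1 * u x))"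
      using q n unfolding admissible_def by blast
    also have "\<dots> = - (LINT x:\<Omega>|lebesgue. f x * u x)"
      by (simp add: set_lebesgue_integral_def)
    finally have "(LINT x:\<Omega>|lebesgue. f x * u x) = vintegral (closure \<Omega>) qp qm (\<lambda>x. -1 *\<^sub>R g x)" by simp
    then show ?thesis
      using vintegral_le_total_variation[OF K, of qp qm "\<lambda>x. -1 *\<^sub>R g x"] q n u(2)
      by (simp add: admissible_def C1_0_def C1_closure_def)
  qed
  then show ?thesis unfolding pd_loc_def p_loc_def
    by (intro SUP_least INF_greatest) auto
qed

text \<open>The inserted 0 gives the value 0 on the empty set, where \<open>Sup\<close> of reals is unspecified.\<close>
definition sup_norm_on :: "'a set \<Rightarrow> ('a \<Rightarrow> 'b::real_normed_vector) \<Rightarrow> real" where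
  "sup_norm_on K g = Sup (insert 0 ((\<lambda>x. norm (g x)) ` K))"

lemma sup_norm_on_bdd:
  fixes g :: "'a::topological_space \<Rightarrow> 'b::real_normed_vector"
  assumes "compact K" "continuous_on K g"
  shows "bdd_above (insert 0 ((\<lambda>x. norm (g x)) ` K))"
  using bounded_imp_bdd_above[OF compact_imp_bounded[OF compact_continuous_image[OF continuous_on_norm[OF assms(2)] assms(1)]]]
  by simp

lemma norm_le_sup_norm_on:
  fixes g :: "'a::topological_space \<Rightarrow> 'b::real_normed_vector"
  assumes "compact K" "continuous_on K g" "x \<in> K"
  shows "norm (g x) \<le> sup_norm_on K g"
  unfolding sup_norm_on_def using sup_norm_on_bdd[OF assms(1,2)] assms(3) by (intro cSup_upper) auto

lemma sup_norm_on_nonneg: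
  fixes g :: "'a::topological_space \<Rightarrow> 'b::real_normed_vector"
  assumes "compact K" "continuous_on K g"
  shows "0 \<le> sup_norm_on K g"
  unfolding sup_norm_on_def using sup_norm_on_bdd[OF assms] by (intro cSup_upper) auto

lemma sup_norm_on_least:
  assumes "0 \<le> b" "\<And>x. x \<in> K \<Longrightarrow> norm (g x) \<le> b"
  shows "sup_norm_on K g \<le> b"
  unfolding sup_norm_on_def using assms by (intro cSup_least) auto

lemma sup_norm_on_add:
  fixes g :: "'a::topological_space \<Rightarrow> 'b::real_normed_vector"
  assumes "compact K" "continuous_on K g" "continuous_on K h"
  shows "sup_norm_on K (\<lambda>x. g x + h x) \<le> sup_norm_on K g + sup_norm_on K h"
  using assms by (intro sup_norm_on_least)
    (auto intro!: add_nonneg_nonneg sup_norm_on_nonneg norm_triangle_mono norm_le_sup_norm_on)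

lemma sup_norm_on_scale:
  fixes g :: "'a::topological_space \<Rightarrow> 'b::real_normed_vector"
  assumes K: "compact K" and g: "continuous_on K g" and c: "0 < c"
  shows "sup_norm_on K (\<lambda>x. c *\<^sub>R g x) = c * sup_norm_on K g"
proof (rule antisym)
  show "sup_norm_on K (\<lambda>x. c *\<^sub>R g x) \<le> c * sup_norm_on K g"
    using c sup_norm_on_nonneg[OF K g] norm_le_sup_norm_on[OF K g] by (intro sup_norm_on_least) auto
  have cg: "continuous_on K (\<lambda>x. c *\<^sub>R g x)" using g by (intro continuous_intros)
  have "norm (g x) \<le> sup_norm_on K (\<lambda>x. c *\<^sub>R g x) / c" if "x \<in> K" for x
    using norm_le_sup_norm_on[OF K cg that] c by (simp add: field_simps)
  then have "sup_norm_on K g \<le> sup_norm_on K (\<lambda>x. c *\<^sub>R g x) / c"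
    using sup_norm_on_nonneg[OF K cg] c by (intro sup_norm_on_least) auto
  then show "c * sup_norm_on K g \<le> sup_norm_on K (\<lambda>x. c *\<^sub>R g x)"
    using c by (simp add: field_simps)
qed

text \<open>Normalising \<phi> by c > b instead of b covers the case b = 0; then c tends to
  b.\<close>

lemma integral_le_pd_loc_times_norm:
  assumes pd: "pd_loc \<Omega> f = ereal M" and M: "0 \<le> M" and \<phi>: "C1_0 \<Omega> \<phi> g"
    and b: "0 \<le> b" "\<And>x. x \<in> closure \<Omega> \<Longrightarrow> norm (g x) \<le> b"
  shows "(LINT x:\<Omega>|lebesgue. f x * \<phi> x) \<le> M * b"
proof -
  have strict: "(LINT x:\<Omega>|lebesgue. f x * \<phi> x) \<le> M * c" if c: "b < c" for c
  proof -
    have c0: "0 < c" using b c by simp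
    have "C1_0 \<Omega> (\<lambda>x. (1/c) * \<phi> x) (\<lambda>x. (1/c) *\<^sub>R g x)" by (rule C1_0_scale[OF \<phi>])
    moreover have "norm ((1/c) *\<^sub>R g x) \<le> 1" if "x \<in> closure \<Omega>" for x
      using b(2)[OF that] c c0 by (simp add: field_simps)
    ultimately have "ereal (LINT x:\<Omega>|lebesgue. f x * ((1/c) * \<phi> x)) \<le> pd_loc \<Omega> f"
      unfolding pd_loc_def by (intro SUP_upper) auto
    then have "(LINT x:\<Omega>|lebesgue. f x * ((1/c) * \<phi> x)) \<le> M" by (simp add: pd)
    moreover have "(LINT x:\<Omega>|lebesgue. f x * ((1/c) * \<phi> x)) = (1/c) * (LINT x:\<Omega>|lebesgue. f x * \<phi> x)"
      by (subst set_integral_mult_right[symmetric]) (simp add: mult.left_commute)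
    ultimately show ?thesis using c0 by (simp add: field_simps)
  qed
  have "(\<lambda>n. M * (b + 1 / real n)) \<longlonglongrightarrow> M * (b + 0)"
    by (intro tendsto_intros lim_1_over_n)
  moreover have "\<exists>N. \<forall>n\<ge>N. (LINT x:\<Omega>|lebesgue. f x * \<phi> x) \<le> M * (b + 1 / real n)"
    by (intro exI[of _ 1] allI impI strict) simp
  ultimately show ?thesis using LIMSEQ_le_const by fastforce
qed

section \<open>Extension and attainment\<close>

lemma subspace_continuous_on: "subspace {g :: 'a::topological_space \<Rightarrow> 'b::real_normed_vector. continuous_on K g}"
  by (auto simp: subspace_def zero_fun_def plus_fun_def scaleR_fun_def intro!: continuous_intros)

lemma ex_admissible_total_variation_le:
  fixes \<Omega> :: "(real^'n) set" and f :: "real^'n \<Rightarrow> real"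
  assumes \<Omega>: "open \<Omega>" "bounded \<Omega>" and f: "f \<in> borel_measurable (lebesgue_on \<Omega>)"
    and f2: "integrable (lebesgue_on \<Omega>) (\<lambda>x. (f x)\<^sup>2)"
    and pd: "pd_loc \<Omega> f = ereal M" and M: "0 \<le> M"
  shows "\<exists>qp qm. admissible \<Omega> f qp qm \<and> total_variation qp qm (closure \<Omega>) \<le> ereal M"
proof -
  define K where "K = closure \<Omega>"
  have K: "compact K" using \<Omega> by (simp add: K_def)
  define E where "E = {g :: real^'n \<Rightarrow> real^'n. continuous_on K g}"
  define I where "I \<phi> = (LINT x:\<Omega>|lebesgue. f x * \<phi> x)" for \<phi>
  \<comment> \<open>A relation, because neither \<phi> nor its integral is recovered from g here; g
    itself is constrained only on K, and the seminorm sees nothing else.\<close>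
  define G where "G = {(g, - I \<phi>) |g \<phi>. C1_0 \<Omega> \<phi> g}"
  note integrable = set_integrable_L2_times_C1_0[OF \<Omega> f f2]
  have I_add: "I (\<lambda>x. \<phi> x + \<psi> x) = I \<phi> + I \<psi>" if "C1_0 \<Omega> \<phi> g" "C1_0 \<Omega> \<psi> h" for \<phi> \<psi> g h
    unfolding I_def distrib_left using integrable[OF that(1)] integrable[OF that(2)] by (rule set_integral_add)
  have I_scale: "I (\<lambda>x. c * \<phi> x) = c * I \<phi>" for c \<phi>
    unfolding I_def by (subst set_integral_mult_right[symmetric]) (simp add: mult.left_commute)
  have CE: "continuous_on K g" if "C1_0 \<Omega> \<phi> g" for \<phi> g
    using that by (simp add: C1_0_def C1_closure_def K_def)
  have G: "subspace G"
    unfolding subspace_def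
  proof (intro conjI ballI allI)
    show "0 \<in> G" unfolding G_def
      using C1_0_zero[of \<Omega>] by (auto simp: zero_prod_def zero_fun_def I_def intro!: exI[of _ "\<lambda>_. 0"])
  next
    fix u v assume "u \<in> G" "v \<in> G"
    then obtain g \<phi> h \<psi> where "C1_0 \<Omega> \<phi> g" "C1_0 \<Omega> \<psi> h" "u = (g, - I \<phi>)" "v = (h, - I \<psi>)"
      by (auto simp: G_def)
    then show "u + v \<in> G" unfolding G_def
      using C1_0_add[of \<Omega> \<phi> g \<psi> h] I_add[of \<phi> g \<psi> h]
      by (auto simp: plus_fun_def intro!: exI[of _ "\<lambda>x. \<phi> x + \<psi> x"])
  next
    fix c u assume "u \<in> G"
    then obtain g \<phi> where "C1_0 \<Omega> \<phi> g" "u = (g, - I \<phi>)" by (auto simp: G_def)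
    then show "c *\<^sub>R u \<in> G" unfolding G_def
      using C1_0_scale[of \<Omega> \<phi> g c] I_scale[of c \<phi>]
      by (auto simp: scaleR_fun_def intro!: exI[of _ "\<lambda>x. c * \<phi> x"])
  qed
  have GE: "fst ` G \<subseteq> E" using CE by (auto simp: G_def E_def)
  have GM: "t \<le> M * sup_norm_on K g" if "(g, t) \<in> G" for g t
  proof -
    obtain \<phi> where \<phi>: "C1_0 \<Omega> \<phi> g" "t = - I \<phi>" using \<open>(g, t) \<in> G\<close> by (auto simp: G_def)
    \<comment> \<open>The second entry of the pair is minus the integral, so the bound by the dual
      value is taken at -\<phi>.\<close>
    have n: "C1_0 \<Omega> (\<lambda>x. -1 * \<phi> x) (\<lambda>x. -1 *\<^sub>R g x)" by (rule C1_0_scale[OF \<phi>(1)])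
    have "I (\<lambda>x. -1 * \<phi> x) \<le> M * sup_norm_on K g"
      unfolding I_def using norm_le_sup_norm_on[OF K CE[OF \<phi>(1)]]
      by (intro integral_le_pd_loc_times_norm[OF pd M n] sup_norm_on_nonneg[OF K CE[OF \<phi>(1)]]) (auto simp: K_def)
    then show ?thesis using I_scale[of "-1" \<phi>] \<phi>(2) by simp
  qed
  have E: "subspace E" unfolding E_def by (rule subspace_continuous_on)
  have sub: "M * sup_norm_on K (g + h) \<le> M * sup_norm_on K g + M * sup_norm_on K h" if "g \<in> E" "h \<in> E" for g h
    using mult_left_mono[OF sup_norm_on_add[OF K, of g h] M] that
    by (simp add: E_def plus_fun_def distrib_left)
  have hom: "M * sup_norm_on K (c *\<^sub>R g) = c * (M * sup_norm_on K g)" if "g \<in> E" "0 < c" for c g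
    using sup_norm_on_scale[OF K, of g c] that by (simp add: E_def scaleR_fun_def)
  obtain \<Lambda> where add: "\<And>g h. g \<in> E \<Longrightarrow> h \<in> E \<Longrightarrow> \<Lambda> (g + h) = \<Lambda> g + \<Lambda> h"
    and scale: "\<And>c g. g \<in> E \<Longrightarrow> \<Lambda> (c *\<^sub>R g) = c * \<Lambda> g"
    and ext: "\<And>g t. (g, t) \<in> G \<Longrightarrow> \<Lambda> g = t"
    and le: "\<And>g. g \<in> E \<Longrightarrow> \<Lambda> g \<le> M * sup_norm_on K g"
    proof (rule Hahn_Banach_graph[where p = "\<lambda>g. M * sup_norm_on K g", OF E sub hom G GE GM])
    fix F
    assume F: "\<And>g h. g \<in> E \<Longrightarrow> h \<in> E \<Longrightarrow> F (g + h) = F g + F h"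
      "\<And>c g. g \<in> E \<Longrightarrow> F (c *\<^sub>R g) = c * F g" "\<And>g t. (g, t) \<in> G \<Longrightarrow> F g = t"
      "\<And>g. g \<in> E \<Longrightarrow> F g \<le> M * sup_norm_on K g"
    show thesis by (rule that[OF F])
  qed
  interpret bounded_vector_functional K \<Lambda> M
  proof
    show "compact K" by (rule K)
    show "\<Lambda> (\<lambda>x. g x + h x) = \<Lambda> g + \<Lambda> h" if "continuous_on K g" "continuous_on K h" for g h
      using add[of g h] that by (simp add: E_def plus_fun_def)
    show "\<Lambda> (\<lambda>x. c *\<^sub>R g x) = c * \<Lambda> g" if "continuous_on K g" for c g
      using scale[of g c] that by (simp add: E_def scaleR_fun_def)
    show "\<Lambda> g \<le> M * b" if "continuous_on K g" "0 \<le> b" "\<And>x. x \<in> K \<Longrightarrow> norm (g x) \<le> b" for b g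
    proof -
      have "\<Lambda> g \<le> M * sup_norm_on K g" using le that(1) by (simp add: E_def)
      also have "\<dots> \<le> M * b" using that M by (intro mult_left_mono sup_norm_on_least) auto
      finally show ?thesis .
    qed
  qed
  have "admissible \<Omega> f pos_part neg_part"
    unfolding admissible_def
  proof (intro conjI allI impI)
    show "vmeasure_on (closure \<Omega>) pos_part neg_part" using vmeasure_on_parts by (simp add: K_def)
    fix \<phi> g assume \<phi>: "C1_0 \<Omega> \<phi> g"
    have "\<Lambda> g = - I \<phi>" using \<phi> by (intro ext) (auto simp: G_def)
    then show "- vintegral (closure \<Omega>) pos_part neg_part g = (LINT x:\<Omega>|lebesgue. f x * \<phi> x)"
      using vintegral_parts[OF CE[OF \<phi>]] by (simp add: K_def I_def)
  qed
  then show ?thesis using total_variation_parts unfolding K_def by blast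
qed

theorem theorem2p2:
  fixes \<Omega> :: "(real^'n) set" and f :: "real^'n \<Rightarrow> real"
  assumes "CARD('n) \<ge> 2"
    and "open \<Omega>" and "bounded \<Omega>" and "connected \<Omega>" and "lipschitz_boundary \<Omega>"
    and "f \<in> borel_measurable (lebesgue_on \<Omega>)"
    and "integrable (lebesgue_on \<Omega>) (\<lambda>x. (f x)\<^sup>2)"
  shows "p_loc \<Omega> f = pd_loc \<Omega> f \<and>
         (p_loc \<Omega> f < \<infinity> \<longrightarrow>
            (\<exists>qp qm. admissible \<Omega> f qp qm \<and> total_variation qp qm (closure \<Omega>) = p_loc \<Omega> f))"
proof -
  have weak: "pd_loc \<Omega> f \<le> p_loc \<Omega> f" by (rule pd_loc_le_p_loc[OF assms(3)])
  have lower: "p_loc \<Omega> f \<le> total_variation qp qm (closure \<Omega>)" if "admissible \<Omega> f qp qm" for qp qm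
    unfolding p_loc_def using that by (intro INF_lower2[of "(qp, qm)"]) auto
  \<comment> \<open>The competitor u = 0 excludes the value -\<infinity> and yields M \<ge> 0, on
    which the sublinearity of M times the supremum norm rests.\<close>
  have "ereal (LINT x:\<Omega>|lebesgue. f x * 0) \<le> pd_loc \<Omega> f"
    unfolding pd_loc_def using C1_0_zero[of \<Omega>]
    by (intro SUP_upper2[of "\<lambda>_. 0"]) (auto intro!: exI[of _ "\<lambda>_. 0"])
  then have nonneg: "0 \<le> pd_loc \<Omega> f" by (simp add: zero_ereal_def)
  show ?thesis
  proof (cases "pd_loc \<Omega> f = \<infinity>")
    \<comment> \<open>Weak duality makes the primal value infinite too, so there is nothing to
      attain.\<close>
    case True
    then show ?thesis using weak by simp
  next
    case False
    then obtain M where M: "pd_loc \<Omega> f = ereal M" "0 \<le> M"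
      using nonneg by (cases "pd_loc \<Omega> f") auto
    obtain qp qm where q: "admissible \<Omega> f qp qm" "total_variation qp qm (closure \<Omega>) \<le> ereal M"
      using ex_admissible_total_variation_le[OF assms(2,3,6,7) M] by blast
    have "p_loc \<Omega> f = pd_loc \<Omega> f"
      using weak lower[OF q(1)] q(2) M(1) by (metis antisym order_trans)
    moreover have "total_variation qp qm (closure \<Omega>) = p_loc \<Omega> f"
      using weak lower[OF q(1)] q(2) M(1) by (metis antisym order_trans)
    ultimately show ?thesis using q(1) by blast
  qed
qed

end
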